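(* Let $\mu$ be a regular cardinal and let $\mathcal{K}$ be an accessible category with $\mu$-directed colimits all of whose morphisms are monomorphisms. Then there is a universal $\mu$-AEC $\mathcal{L}$ and an essentially surjective faithful functor $F:\mathcal{L}\to\mathcal{K}$ preserving $\mu$-directed colimits.
   Context: A category is $\lambda$-accessible if it has $\lambda$-directed colimits and a set $S$ of $\lambda$-presentable objects (objects whose hom-functor preserves $\lambda$-directed colimits) such that every object is a $\lambda$-directed colimit of objects in $S$; it is accessible if it is $\lambda$-accessible for some regular $\lambda$. A universal $\mu$-AEC is a class of structures in a fixed vocabulary whose symbols have arity $<\mu$, closed under isomorphism, substructures, and unions of $\mu$-directed systems of substructure inclusions, viewed as a category whose morphisms are substructure embeddings (isomorphisms onto a substructure). A functor is essentially surjective if every object of its codomain is isomorphic to an object in its image. *)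

theory Defs
  imports Main "HOL-Library.FuncSet"
begin

unbundle cardinal_syntax

text \<open>
  Size convention. A type \<open>'u\<close> plays the role of the universe: \<open>small\<close> means of cardinality less
  than that of \<open>'u\<close>, and small sets are the "sets" of the informal text, arbitrary sets (of any type)
  are its "classes". Every small set has a copy among the subsets of \<open>'u\<close>, so cardinals,
  index posets, vocabularies and underlying sets of structures are taken inside \<open>'u\<close> without loss.
  The cardinality of \<open>'u\<close> is only required to be regular, that is, small unions of small sets are
  small; a Grothendieck universe is the case where it is strongly inaccessible.
\<close>

definition regular_universe :: "'u itself \<Rightarrow> bool" where
  "regular_universe _ \<longleftrightarrow> infinite (UNIV :: 'u set) \<and> regularCard |UNIV :: 'u set|"

definition small :: "'u itself \<Rightarrow> 'a set \<Rightarrow> bool" where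
  "small _ A \<longleftrightarrow> |A| <o |UNIV :: 'u set|"

definition regular_cardinal :: "'u rel \<Rightarrow> bool" where
  "regular_cardinal \<mu> \<longleftrightarrow> Card_order \<mu> \<and> cinfinite \<mu> \<and> regularCard \<mu> \<and> \<mu> <o |UNIV :: 'u set|"


section \<open>Categories and functors\<close>

record ('o, 'm) cat =
  Obj :: "'o set"
  Arr :: "'m set"
  src :: "'m \<Rightarrow> 'o"
  trg :: "'m \<Rightarrow> 'o"
  idt :: "'o \<Rightarrow> 'm"
  cmp :: "'m \<Rightarrow> 'm \<Rightarrow> 'm"  \<comment> \<open>\<open>cmp C g f\<close> is \<open>g\<close> after \<open>f\<close>\<close>

definition hom :: "('o, 'm) cat \<Rightarrow> 'o \<Rightarrow> 'o \<Rightarrow> 'm set" where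
  "hom C X Y = {f \<in> Arr C. src C f = X \<and> trg C f = Y}"

locale category =
  fixes C :: "('o, 'm) cat"
  assumes src_Obj: "f \<in> Arr C \<Longrightarrow> src C f \<in> Obj C"
    and trg_Obj: "f \<in> Arr C \<Longrightarrow> trg C f \<in> Obj C"
    and idt_hom: "X \<in> Obj C \<Longrightarrow> idt C X \<in> hom C X X"
    and cmp_hom: "f \<in> hom C X Y \<Longrightarrow> g \<in> hom C Y Z \<Longrightarrow> cmp C g f \<in> hom C X Z"
    and cmp_idt_right: "f \<in> hom C X Y \<Longrightarrow> cmp C f (idt C X) = f"
    and cmp_idt_left: "f \<in> hom C X Y \<Longrightarrow> cmp C (idt C Y) f = f"
    and cmp_assoc: "f \<in> hom C W X \<Longrightarrow> g \<in> hom C X Y \<Longrightarrow> h \<in> hom C Y Z \<Longrightarrow>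
      cmp C h (cmp C g f) = cmp C (cmp C h g) f"

definition monomorphism :: "('o, 'm) cat \<Rightarrow> 'm \<Rightarrow> bool" where
  "monomorphism C f \<longleftrightarrow> f \<in> Arr C \<and>
    (\<forall>W. \<forall>g \<in> hom C W (src C f). \<forall>h \<in> hom C W (src C f). cmp C f g = cmp C f h \<longrightarrow> g = h)"

definition isomorphic :: "('o, 'm) cat \<Rightarrow> 'o \<Rightarrow> 'o \<Rightarrow> bool" where
  "isomorphic C X Y \<longleftrightarrow> X \<in> Obj C \<and> Y \<in> Obj C \<and>
    (\<exists>f \<in> hom C X Y. \<exists>g \<in> hom C Y X. cmp C g f = idt C X \<and> cmp C f g = idt C Y)"

definition locally_small :: "'u itself \<Rightarrow> ('o, 'm) cat \<Rightarrow> bool" where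
  "locally_small U C \<longleftrightarrow> (\<forall>X \<in> Obj C. \<forall>Y \<in> Obj C. small U (hom C X Y))"

record ('o1, 'm1, 'o2, 'm2) fnctr =
  omap :: "'o1 \<Rightarrow> 'o2"
  amap :: "'m1 \<Rightarrow> 'm2"

locale is_functor =
  C: category C + D: category D
  for C :: "('o1, 'm1) cat" and D :: "('o2, 'm2) cat" +
  fixes F :: "('o1, 'm1, 'o2, 'm2) fnctr"
  assumes omap_Obj: "X \<in> Obj C \<Longrightarrow> omap F X \<in> Obj D"
    and amap_hom: "f \<in> hom C X Y \<Longrightarrow> amap F f \<in> hom D (omap F X) (omap F Y)"
    and amap_idt: "X \<in> Obj C \<Longrightarrow> amap F (idt C X) = idt D (omap F X)"
    and amap_cmp: "f \<in> hom C X Y \<Longrightarrow> g \<in> hom C Y Z \<Longrightarrow>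
      amap F (cmp C g f) = cmp D (amap F g) (amap F f)"

definition functor_comp ::
    "('o2, 'm2, 'o3, 'm3) fnctr \<Rightarrow> ('o1, 'm1, 'o2, 'm2) fnctr \<Rightarrow> ('o1, 'm1, 'o3, 'm3) fnctr" where
  "functor_comp G F = \<lparr>omap = omap G \<circ> omap F, amap = amap G \<circ> amap F\<rparr>"

definition faithful ::
    "('o1, 'm1) cat \<Rightarrow> ('o1, 'm1, 'o2, 'm2) fnctr \<Rightarrow> bool" where
  "faithful C F \<longleftrightarrow> (\<forall>X \<in> Obj C. \<forall>Y \<in> Obj C. inj_on (amap F) (hom C X Y))"

definition essentially_surjective ::
    "('o1, 'm1) cat \<Rightarrow> ('o2, 'm2) cat \<Rightarrow> ('o1, 'm1, 'o2, 'm2) fnctr \<Rightarrow> bool" where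
  "essentially_surjective C D F \<longleftrightarrow> (\<forall>Y \<in> Obj D. \<exists>X \<in> Obj C. isomorphic D (omap F X) Y)"


section \<open>Directed colimits\<close>

definition is_cocone ::
    "('i, 'j) cat \<Rightarrow> ('o, 'm) cat \<Rightarrow> ('i, 'j, 'o, 'm) fnctr \<Rightarrow> 'o \<Rightarrow> ('i \<Rightarrow> 'm) \<Rightarrow> bool" where
  "is_cocone J C G X c \<longleftrightarrow> X \<in> Obj C \<and>
    (\<forall>i \<in> Obj J. c i \<in> hom C (omap G i) X) \<and>
    (\<forall>i j. \<forall>e \<in> hom J i j. cmp C (c j) (amap G e) = c i)"

definition is_colimit ::
    "('i, 'j) cat \<Rightarrow> ('o, 'm) cat \<Rightarrow> ('i, 'j, 'o, 'm) fnctr \<Rightarrow> 'o \<Rightarrow> ('i \<Rightarrow> 'm) \<Rightarrow> bool" where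
  "is_colimit J C G X c \<longleftrightarrow> is_cocone J C G X c \<and>
    (\<forall>Y d. is_cocone J C G Y d \<longrightarrow>
      (\<exists>!h. h \<in> hom C X Y \<and> (\<forall>i \<in> Obj J. cmp C h (c i) = d i)))"

text \<open>The bound over the empty subset makes a \<open>\<mu>\<close>-directed poset nonempty.\<close>

definition directed_poset :: "'u rel \<Rightarrow> 'u set \<Rightarrow> 'u rel \<Rightarrow> bool" where
  "directed_poset \<mu> I r \<longleftrightarrow> small TYPE('u) I \<and> partial_order_on I r \<and>
    (\<forall>X \<subseteq> I. |X| <o \<mu> \<longrightarrow> (\<exists>b \<in> I. \<forall>x \<in> X. (x, b) \<in> r))"

definition poset_cat :: "'i set \<Rightarrow> 'i rel \<Rightarrow> ('i, 'i \<times> 'i) cat" where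
  "poset_cat I r = \<lparr>Obj = I, Arr = r, src = fst, trg = snd, idt = (\<lambda>i. (i, i)),
    cmp = (\<lambda>g f. (fst f, snd g))\<rparr>"

definition has_directed_colimits :: "'u rel \<Rightarrow> ('o, 'm) cat \<Rightarrow> bool" where
  "has_directed_colimits \<mu> C \<longleftrightarrow>
    (\<forall>I r G. directed_poset \<mu> I r \<longrightarrow> is_functor (poset_cat I r) C G \<longrightarrow>
      (\<exists>X c. is_colimit (poset_cat I r) C G X c))"

definition preserves_directed_colimits ::
    "'u rel \<Rightarrow> ('o1, 'm1) cat \<Rightarrow> ('o2, 'm2) cat \<Rightarrow> ('o1, 'm1, 'o2, 'm2) fnctr \<Rightarrow> bool" where
  "preserves_directed_colimits \<mu> C D F \<longleftrightarrow>
    (\<forall>I r G X c. directed_poset \<mu> I r \<longrightarrow> is_functor (poset_cat I r) C G \<longrightarrow>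
      is_colimit (poset_cat I r) C G X c \<longrightarrow>
      is_colimit (poset_cat I r) D (functor_comp F G) (omap F X) (\<lambda>i. amap F (c i)))"


section \<open>Accessible categories\<close>

definition set_cat :: "'u itself \<Rightarrow> ('a set, 'a set \<times> ('a \<Rightarrow> 'a) \<times> 'a set) cat" where
  "set_cat U = \<lparr>Obj = {A. small U A},
    Arr = {(A, f, B). small U A \<and> small U B \<and> f \<in> A \<rightarrow>\<^sub>E B},
    src = (\<lambda>(A, f, B). A), trg = (\<lambda>(A, f, B). B),
    idt = (\<lambda>A. (A, \<lambda>x\<in>A. x, A)),
    cmp = (\<lambda>(B, g, D) (A, f, B'). (A, compose A g f, D))\<rparr>"

text \<open>
  The covariant hom-functor. Its values are sets of elements of \<open>'m + 'u\<close>: the arrows are tagged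
  by \<open>Inl\<close>, and the summand \<open>'u\<close> only serves to make the target category contain a copy of
  every small set, whatever the type \<open>'m\<close> of arrows is.
\<close>

definition hom_functor :: "('o, 'm) cat \<Rightarrow> 'o \<Rightarrow>
    ('o, 'm, ('m + 'u) set, ('m + 'u) set \<times> ('m + 'u \<Rightarrow> 'm + 'u) \<times> ('m + 'u) set) fnctr" where
  "hom_functor C X = \<lparr>omap = (\<lambda>Y. Inl ` hom C X Y),
    amap = (\<lambda>f. (Inl ` hom C X (src C f),
                 \<lambda>z \<in> Inl ` hom C X (src C f). Inl (cmp C f (projl z)),
                 Inl ` hom C X (trg C f)))\<rparr>"

definition presentable :: "'u rel \<Rightarrow> ('o, 'm) cat \<Rightarrow> 'o \<Rightarrow> bool" where
  "presentable \<mu> C X \<longleftrightarrow> X \<in> Obj C \<and>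
    preserves_directed_colimits \<mu> C (set_cat TYPE('u))
      (hom_functor C X ::
        (_, _, ('m + 'u) set, ('m + 'u) set \<times> ('m + 'u \<Rightarrow> 'm + 'u) \<times> ('m + 'u) set) fnctr)"

definition directed_colimit_of :: "'u rel \<Rightarrow> ('o, 'm) cat \<Rightarrow> 'o set \<Rightarrow> 'o \<Rightarrow> bool" where
  "directed_colimit_of \<mu> C S X \<longleftrightarrow>
    (\<exists>I r G c. directed_poset \<mu> I r \<and> is_functor (poset_cat I r) C G \<and>
      (\<forall>i \<in> I. omap G i \<in> S) \<and> is_colimit (poset_cat I r) C G X c)"

text \<open>Local smallness is the usual convention without which the hom-functors above do not exist.\<close>

definition accessible_at :: "'u rel \<Rightarrow> ('o, 'm) cat \<Rightarrow> bool" where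
  "accessible_at \<mu> C \<longleftrightarrow> category C \<and> locally_small TYPE('u) C \<and> has_directed_colimits \<mu> C \<and>
    (\<exists>S. small TYPE('u) S \<and> (\<forall>X \<in> S. presentable \<mu> C X) \<and>
      (\<forall>X \<in> Obj C. directed_colimit_of \<mu> C S X))"

definition accessible :: "'u itself \<Rightarrow> ('o, 'm) cat \<Rightarrow> bool" where
  "accessible _ C \<longleftrightarrow> (\<exists>\<mu> :: 'u rel. regular_cardinal \<mu> \<and> accessible_at \<mu> C)"


section \<open>Universal \<open>\<mu>\<close>-AECs\<close>

text \<open>
  The arity of a symbol is an index set for its arguments, so that an argument tuple from \<open>A\<close> is an
  element of \<open>arity \<rightarrow>\<^sub>E A\<close>.
\<close>

record 'u vocabulary =
  funs :: "'u set"
  rels :: "'u set"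
  fun_arity :: "'u \<Rightarrow> 'u set"
  rel_arity :: "'u \<Rightarrow> 'u set"

definition is_vocabulary :: "'u rel \<Rightarrow> 'u vocabulary \<Rightarrow> bool" where
  "is_vocabulary \<mu> \<tau> \<longleftrightarrow> small TYPE('u) (funs \<tau>) \<and> small TYPE('u) (rels \<tau>) \<and>
    (\<forall>f \<in> funs \<tau>. |fun_arity \<tau> f| <o \<mu>) \<and> (\<forall>R \<in> rels \<tau>. |rel_arity \<tau> R| <o \<mu>)"

record 'u struct =
  carrier :: "'u set"
  fun_interp :: "'u \<Rightarrow> ('u \<Rightarrow> 'u) \<Rightarrow> 'u"
  rel_interp :: "'u \<Rightarrow> ('u \<Rightarrow> 'u) set"

text \<open>
  Interpretations are fixed outside the vocabulary, so that equality of structures is equality of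
  carriers and interpretations. The empty structure is allowed (if there are no constants).
\<close>

definition is_struct :: "'u vocabulary \<Rightarrow> 'u struct \<Rightarrow> bool" where
  "is_struct \<tau> M \<longleftrightarrow> small TYPE('u) (carrier M) \<and>
    fun_interp M \<in> (\<Pi>\<^sub>E f \<in> funs \<tau>. (fun_arity \<tau> f \<rightarrow>\<^sub>E carrier M) \<rightarrow>\<^sub>E carrier M) \<and>
    (\<forall>R \<in> rels \<tau>. rel_interp M R \<subseteq> rel_arity \<tau> R \<rightarrow>\<^sub>E carrier M) \<and>
    (\<forall>R. R \<notin> rels \<tau> \<longrightarrow> rel_interp M R = {})"

definition substructure :: "'u vocabulary \<Rightarrow> 'u struct \<Rightarrow> 'u struct \<Rightarrow> bool" where
  "substructure \<tau> M N \<longleftrightarrow> is_struct \<tau> M \<and> is_struct \<tau> N \<and> carrier M \<subseteq> carrier N \<and>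
    (\<forall>f \<in> funs \<tau>. \<forall>t \<in> fun_arity \<tau> f \<rightarrow>\<^sub>E carrier M. fun_interp M f t = fun_interp N f t) \<and>
    (\<forall>R \<in> rels \<tau>. rel_interp M R = rel_interp N R \<inter> (rel_arity \<tau> R \<rightarrow>\<^sub>E carrier M))"

definition struct_iso :: "'u vocabulary \<Rightarrow> ('u \<Rightarrow> 'u) \<Rightarrow> 'u struct \<Rightarrow> 'u struct \<Rightarrow> bool" where
  "struct_iso \<tau> h M N \<longleftrightarrow> is_struct \<tau> M \<and> is_struct \<tau> N \<and>
    h \<in> extensional (carrier M) \<and> bij_betw h (carrier M) (carrier N) \<and>
    (\<forall>f \<in> funs \<tau>. \<forall>t \<in> fun_arity \<tau> f \<rightarrow>\<^sub>E carrier M.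
      h (fun_interp M f t) = fun_interp N f (compose (fun_arity \<tau> f) h t)) \<and>
    (\<forall>R \<in> rels \<tau>. \<forall>t \<in> rel_arity \<tau> R \<rightarrow>\<^sub>E carrier M.
      t \<in> rel_interp M R \<longleftrightarrow> compose (rel_arity \<tau> R) h t \<in> rel_interp N R)"

definition embedding :: "'u vocabulary \<Rightarrow> ('u \<Rightarrow> 'u) \<Rightarrow> 'u struct \<Rightarrow> 'u struct \<Rightarrow> bool" where
  "embedding \<tau> h M N \<longleftrightarrow> (\<exists>N'. substructure \<tau> N' N \<and> struct_iso \<tau> h M N')"

text \<open>
  The union of a \<open>\<mu>\<close>-directed system of substructure inclusions: every argument tuple, having fewer
  than \<open>\<mu>\<close> entries, lies in some member, and all members containing it give the same value.
\<close>

definition struct_union :: "'u vocabulary \<Rightarrow> 'u set \<Rightarrow> ('u \<Rightarrow> 'u struct) \<Rightarrow> 'u struct" where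
  "struct_union \<tau> I M = \<lparr>carrier = (\<Union>i\<in>I. carrier (M i)),
    fun_interp = (\<lambda>f\<in>funs \<tau>. \<lambda>t \<in> fun_arity \<tau> f \<rightarrow>\<^sub>E (\<Union>i\<in>I. carrier (M i)).
      fun_interp (M (SOME i. i \<in> I \<and> t \<in> fun_arity \<tau> f \<rightarrow>\<^sub>E carrier (M i))) f t),
    rel_interp = (\<lambda>R. \<Union>i\<in>I. rel_interp (M i) R)\<rparr>"

definition universal_AEC :: "'u rel \<Rightarrow> 'u vocabulary \<Rightarrow> 'u struct set \<Rightarrow> bool" where
  "universal_AEC \<mu> \<tau> L \<longleftrightarrow> is_vocabulary \<mu> \<tau> \<and>
    (\<forall>M \<in> L. is_struct \<tau> M) \<and>
    (\<forall>M \<in> L. \<forall>N h. struct_iso \<tau> h M N \<longrightarrow> N \<in> L) \<and>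
    (\<forall>N \<in> L. \<forall>M. substructure \<tau> M N \<longrightarrow> M \<in> L) \<and>
    (\<forall>I r M. directed_poset \<mu> I r \<longrightarrow> (\<forall>i \<in> I. M i \<in> L) \<longrightarrow>
      (\<forall>(i, j) \<in> r. substructure \<tau> (M i) (M j)) \<longrightarrow> struct_union \<tau> I M \<in> L)"

definition AEC_cat :: "'u vocabulary \<Rightarrow> 'u struct set \<Rightarrow>
    ('u struct, 'u struct \<times> ('u \<Rightarrow> 'u) \<times> 'u struct) cat" where
  "AEC_cat \<tau> L = \<lparr>Obj = L,
    Arr = {(M, h, N). M \<in> L \<and> N \<in> L \<and> embedding \<tau> h M N},
    src = (\<lambda>(M, h, N). M), trg = (\<lambda>(M, h, N). N),
    idt = (\<lambda>M. (M, \<lambda>x\<in>carrier M. x, M)),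
    cmp = (\<lambda>(N, g, P) (M, f, N'). (M, compose (carrier M) g f, P))\<rparr>"

end

theory Submission
  imports Defs
begin

text \<open>
  Let \<open>\<kappa>\<close> be an index of accessibility of \<open>K\<close>, and \<open>\<nu>\<close> the smaller of \<open>\<kappa>\<close> and \<open>\<mu>\<close>. Then \<open>K\<close> has
  \<open>\<nu>\<close>-directed colimits, every object is a \<open>\<nu>\<close>-directed colimit of objects of a small set \<open>S\<close>, and
  since a \<open>\<mu>\<close>-directed poset is \<open>\<nu>\<close>-directed, a universal \<open>\<nu>\<close>-AEC is a universal \<open>\<mu>\<close>-AEC. So no index
  of accessibility has to be raised.

  The structures of the class are \<open>\<nu>\<close>-directed posets together with a diagram of that shape in \<open>S\<close>:
  a binary relation for each arrow of \<open>S\<close> records the edges, and Skolem functions of arity below \<open>\<nu>\<close>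
  choose upper bounds, which makes the class closed under substructures. The functor takes such a
  diagram to its colimit. As arrows are monic, two elements \<open>x\<close>, \<open>y\<close> of the same sort have the same
  colimit leg iff their edges to a common upper bound \<open>z\<close> carry the same arrow. Forbidding this for
  \<open>x \<noteq> y\<close> is a universal condition and makes the functor faithful. Essential surjectivity survives
  it: given a diagram with colimit \<open>X\<close>, choose one index for each subobject of \<open>X\<close> that occurs as a
  leg, and order these indices by factorization.
\<close>

section \<open>Small sets and regular cardinals\<close>

text \<open>Regularity of the cardinality of \<open>'u\<close> enters here; it later makes the set
  \<open>arrs\<close> and unions of directed systems of structures small.\<close>

lemma small_UNION:
  assumes "regular_universe TYPE('u)" "small TYPE('u) I" "\<And>i. i \<in> I \<Longrightarrow> small TYPE('u) (A i)"
  shows "small TYPE('u) (\<Union>i\<in>I. A i)"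
  using assms regularCard_UNION_bound[of "|UNIV :: 'u set|" I A]
  by (simp add: regular_universe_def small_def cinfinite_def card_of_card_order_on Field_card_of)

lemma small_subset: "small TYPE('u) B \<Longrightarrow> A \<subseteq> B \<Longrightarrow> small TYPE('u) A"
  unfolding small_def using card_of_mono1 ordLeq_ordLess_trans by blast

lemma card_of_image_ordLess: "|A| <o r \<Longrightarrow> |f ` A| <o r"
  using card_of_image ordLeq_ordLess_trans by blast

lemma regular_cardinal_Well_order: "regular_cardinal \<nu> \<Longrightarrow> Well_order \<nu>"
  unfolding regular_cardinal_def by (blast intro: card_order_on_well_order_on)

lemma regular_cardinal_finite: "regular_cardinal \<nu> \<Longrightarrow> finite X \<Longrightarrow> |X| <o \<nu>"
  unfolding regular_cardinal_def
  by (intro Cfinite_ordLess_Cinfinite) (auto simp: cfinite_def card_of_card_order_on Field_card_of)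

lemma regular_cardinal_underS:
  "regular_cardinal \<nu> \<Longrightarrow> \<alpha> \<in> Field \<nu> \<Longrightarrow> |underS \<nu> \<alpha>| <o \<nu>"
  unfolding regular_cardinal_def by (blast intro: card_of_underS)

text \<open>A well-order strictly below \<nu> is isomorphic to the restriction of \<nu> to some
  \<open>underS \<nu> \<alpha>\<close>. So every set of fewer than \<nu> elements is the range of a
  tuple indexed by the arity of one of the symbols that choose upper bounds.\<close>

lemma ordLess_enumerate:
  assumes "Well_order \<nu>" "|X| <o \<nu>"
  obtains \<alpha> f where "\<alpha> \<in> Field \<nu>" "bij_betw f (underS \<nu> \<alpha>) X"
proof -
  obtain \<alpha> where a: "\<alpha> \<in> Field \<nu>" "|X| =o Restr \<nu> (underS \<nu> \<alpha>)"
    using assms ordLess_iff_ordIso_Restr card_of_Well_order by blast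
  have "Field (Restr \<nu> (underS \<nu> \<alpha>)) = underS \<nu> \<alpha>"
    using assms(1) by (intro Refl_Field_Restr2) (auto simp: order_on_defs underS_def Field_def)
  moreover obtain g where "iso ( |X| ) (Restr \<nu> (underS \<nu> \<alpha>)) g"
    using a(2) by (auto simp: ordIso_def)
  ultimately have "bij_betw g X (underS \<nu> \<alpha>)"
    by (simp add: iso_def Field_card_of)
  then show ?thesis using that[OF a(1)] bij_betw_inv_into by blast
qed


section \<open>Categories and directed diagrams\<close>

lemma colimit_desc:
  assumes "is_colimit J C G X c" "is_cocone J C G Y d"
  shows "\<exists>h \<in> hom C X Y. \<forall>i \<in> Obj J. cmp C h (c i) = d i"
  using assms unfolding is_colimit_def by blast

lemma colimit_eq:
  assumes "is_colimit J C G X c" "is_cocone J C G Y d" "h \<in> hom C X Y" "h' \<in> hom C X Y"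
    "\<And>i. i \<in> Obj J \<Longrightarrow> cmp C h (c i) = d i" "\<And>i. i \<in> Obj J \<Longrightarrow> cmp C h' (c i) = d i"
  shows "h = h'"
proof -
  have "\<exists>!h. h \<in> hom C X Y \<and> (\<forall>i \<in> Obj J. cmp C h (c i) = d i)"
    using assms(1,2) by (simp add: is_colimit_def)
  then show ?thesis using assms(3-6) by blast
qed

context category
begin

lemma homD: "f \<in> hom C X Y \<Longrightarrow> f \<in> Arr C \<and> src C f = X \<and> trg C f = Y \<and> X \<in> Obj C \<and> Y \<in> Obj C"
  using src_Obj trg_Obj by (auto simp: hom_def)

lemma mono_cancel:
  assumes "\<forall>f \<in> Arr C. monomorphism C f" "c \<in> hom C X Y" "f \<in> hom C W X" "g \<in> hom C W X"
    "cmp C c f = cmp C c g"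
  shows "f = g"
  using assms by (auto simp: monomorphism_def hom_def)

text \<open>Compares an arbitrarily chosen colimit of a diagram with a given object that is also a
  colimit of it, which is how the argument for essential surjectivity ends.\<close>

lemma colimit_isomorphic:
  assumes X: "is_colimit J C G X c" and Y: "is_colimit J C G Y d"
  shows "isomorphic C X Y"
proof -
  have XY: "X \<in> Obj C" "Y \<in> Obj C" and cX: "is_cocone J C G X c" and cY: "is_cocone J C G Y d"
    using assms by (auto simp: is_colimit_def is_cocone_def)
  have c: "c i \<in> hom C (omap G i) X" and d: "d i \<in> hom C (omap G i) Y" if "i \<in> Obj J" for i
    using that cX cY by (auto simp: is_cocone_def)
  obtain f where f: "f \<in> hom C X Y" "\<And>i. i \<in> Obj J \<Longrightarrow> cmp C f (c i) = d i"
    using colimit_desc[OF X cY] by blast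
  obtain g where g: "g \<in> hom C Y X" "\<And>i. i \<in> Obj J \<Longrightarrow> cmp C g (d i) = c i"
    using colimit_desc[OF Y cX] by blast
  have "cmp C g f = idt C X"
  proof (rule colimit_eq[OF X cX])
    fix i assume i: "i \<in> Obj J"
    show "cmp C (cmp C g f) (c i) = c i"
      using cmp_assoc[OF c[OF i] f(1) g(1)] f(2) g(2) i by simp
    show "cmp C (idt C X) (c i) = c i" using cmp_idt_left c i by blast
  qed (use f g XY in \<open>auto intro: cmp_hom idt_hom\<close>)
  moreover have "cmp C f g = idt C Y"
  proof (rule colimit_eq[OF Y cY])
    fix i assume i: "i \<in> Obj J"
    show "cmp C (cmp C f g) (d i) = d i"
      using cmp_assoc[OF d[OF i] g(1) f(1)] f(2) g(2) i by simp
    show "cmp C (idt C Y) (d i) = d i" using cmp_idt_left d i by blast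
  qed (use f g XY in \<open>auto intro: cmp_hom idt_hom\<close>)
  ultimately show ?thesis using f g XY by (auto simp: isomorphic_def)
qed

end

section \<open>Directed posets and diagrams indexed by them\<close>

lemma directed_posetD:
  assumes "directed_poset \<mu> I r"
  shows "small TYPE('u) (I :: 'u set)" "partial_order_on I r" "r \<subseteq> I \<times> I"
    "i \<in> I \<Longrightarrow> (i, i) \<in> r" "(i, j) \<in> r \<Longrightarrow> (j, k) \<in> r \<Longrightarrow> (i, k) \<in> r"
    "(i, j) \<in> r \<Longrightarrow> (j, i) \<in> r \<Longrightarrow> i = j"
proof -
  have "small TYPE('u) I" "partial_order_on I r" using assms by (auto simp: directed_poset_def)
  moreover from this have "r \<subseteq> I \<times> I" "refl_on I r" "trans r" "antisym r"
    by (auto simp: order_on_defs)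
  ultimately show "small TYPE('u) I" "partial_order_on I r" "r \<subseteq> I \<times> I"
    "i \<in> I \<Longrightarrow> (i, i) \<in> r" "(i, j) \<in> r \<Longrightarrow> (j, k) \<in> r \<Longrightarrow> (i, k) \<in> r"
    "(i, j) \<in> r \<Longrightarrow> (j, i) \<in> r \<Longrightarrow> i = j"
    by (auto simp: refl_on_def antisym_def) (meson transD)
qed

lemma directed_poset_bound:
  assumes "directed_poset \<mu> I r" "X \<subseteq> I" "|X| <o \<mu>"
  shows "\<exists>b\<in>I. \<forall>x\<in>X. (x, b) \<in> r"
  using assms by (simp add: directed_poset_def)

lemma directed_poset_bound2:
  assumes "regular_cardinal \<mu>" "directed_poset \<mu> I r" "i \<in> I" "j \<in> I"
  shows "\<exists>k\<in>I. (i, k) \<in> r \<and> (j, k) \<in> r"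
  using directed_poset_bound[OF assms(2), of "{i, j}"] assms regular_cardinal_finite[of \<mu> "{i, j}"]
  by simp

lemma directed_poset_nonempty:
  assumes "regular_cardinal \<mu>" "directed_poset \<mu> I r"
  shows "\<exists>i. i \<in> I"
  using directed_poset_bound[OF assms(2), of "{}"] regular_cardinal_finite[OF assms(1), of "{}"]
  by auto

text \<open>A smaller cardinal leaves fewer subsets to be bounded. Every change of index in the
  final argument reduces to this.\<close>

lemma directed_poset_mono:
  assumes "directed_poset \<mu> I r" "\<nu> \<le>o \<mu>"
  shows "directed_poset \<nu> I r"
  using assms ordLess_ordLeq_trans unfolding directed_poset_def by blast

lemma poset_cat_simps [simp]:
  "Obj (poset_cat I r) = I" "Arr (poset_cat I r) = r" "idt (poset_cat I r) i = (i, i)"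
  "cmp (poset_cat I r) q p = (fst p, snd q)" "p \<in> hom (poset_cat I r) i j \<longleftrightarrow> p = (i, j) \<and> (i, j) \<in> r"
  by (auto simp: poset_cat_def hom_def)

lemma category_poset_cat:
  assumes "partial_order_on I r"
  shows "category (poset_cat I r)"
proof -
  have "r \<subseteq> I \<times> I" "\<And>i. i \<in> I \<Longrightarrow> (i, i) \<in> r" "\<And>i j k. (i, j) \<in> r \<Longrightarrow> (j, k) \<in> r \<Longrightarrow> (i, k) \<in> r"
    using assms unfolding order_on_defs refl_on_def trans_def by blast+
  then show ?thesis by unfold_locales (auto simp: poset_cat_def hom_def)
qed

lemma is_functor_poset_cat:
  "is_functor (poset_cat I r) C G \<longleftrightarrow> category (poset_cat I r) \<and> category C \<and>
    (\<forall>i\<in>I. omap G i \<in> Obj C) \<and> (\<forall>(i, j)\<in>r. amap G (i, j) \<in> hom C (omap G i) (omap G j)) \<and>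
    (\<forall>i\<in>I. amap G (i, i) = idt C (omap G i)) \<and>
    (\<forall>i j k. (i, j) \<in> r \<longrightarrow> (j, k) \<in> r \<longrightarrow> amap G (i, k) = cmp C (amap G (j, k)) (amap G (i, j)))"
  unfolding is_functor_def is_functor_axioms_def poset_cat_simps by auto

lemma is_cocone_poset_cat:
  "is_cocone (poset_cat I r) C G X c \<longleftrightarrow> X \<in> Obj C \<and> (\<forall>i\<in>I. c i \<in> hom C (omap G i) X) \<and>
    (\<forall>(i, j)\<in>r. cmp C (c j) (amap G (i, j)) = c i)"
  unfolding is_cocone_def poset_cat_simps by auto


section \<open>Structures and embeddings\<close>

lemma is_structD:
  assumes "is_struct \<tau> M"
  shows "small TYPE('u) (carrier (M :: 'u struct))"
    "f \<in> funs \<tau> \<Longrightarrow> t \<in> fun_arity \<tau> f \<rightarrow>\<^sub>E carrier M \<Longrightarrow> fun_interp M f t \<in> carrier M"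
    "R \<in> rels \<tau> \<Longrightarrow> t \<in> rel_interp M R \<Longrightarrow> t \<in> rel_arity \<tau> R \<rightarrow>\<^sub>E carrier M"
proof -
  have M: "small TYPE('u) (carrier M)"
    "fun_interp M \<in> (\<Pi>\<^sub>E f \<in> funs \<tau>. (fun_arity \<tau> f \<rightarrow>\<^sub>E carrier M) \<rightarrow>\<^sub>E carrier M)"
    "\<forall>R \<in> rels \<tau>. rel_interp M R \<subseteq> rel_arity \<tau> R \<rightarrow>\<^sub>E carrier M"
    using assms by (simp_all add: is_struct_def)
  show "small TYPE('u) (carrier M)" by (fact M(1))
  show "fun_interp M f t \<in> carrier M" if "f \<in> funs \<tau>" "t \<in> fun_arity \<tau> f \<rightarrow>\<^sub>E carrier M"
    using PiE_mem[OF PiE_mem[OF M(2) that(1)] that(2)] .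
  show "t \<in> rel_arity \<tau> R \<rightarrow>\<^sub>E carrier M" if "R \<in> rels \<tau>" "t \<in> rel_interp M R"
    using M(3) that by blast
qed

lemma compose_PiE: "h \<in> A \<rightarrow> B \<Longrightarrow> t \<in> X \<rightarrow>\<^sub>E A \<Longrightarrow> compose X h t \<in> X \<rightarrow>\<^sub>E B"
  unfolding compose_def by (intro restrict_PiE_iff[THEN iffD2] ballI) (blast dest: PiE_mem)

lemma compose_compose: "t \<in> X \<rightarrow>\<^sub>E A \<Longrightarrow> compose X (compose A g h) t = compose X g (compose X h t)"
  unfolding compose_def by (intro restrict_ext) (auto dest: PiE_mem)

lemma compose_restrict_id: "t \<in> X \<rightarrow>\<^sub>E A \<Longrightarrow> compose X (\<lambda>x\<in>A. x) t = t"
  by (rule ext) (metis compose_def restrict_apply PiE_mem PiE_arb)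

text \<open>Preimages are chosen entry by entry. Outside \<open>X\<close> both tuples take the
  default value \<open>undefined\<close>, so they are equal as functions.\<close>

lemma PiE_image_lift:
  assumes t: "t \<in> X \<rightarrow>\<^sub>E h ` A"
  shows "\<exists>s \<in> X \<rightarrow>\<^sub>E A. compose X h s = t"
proof
  let ?s = "\<lambda>a\<in>X. inv_into A h (t a)"
  show "?s \<in> X \<rightarrow>\<^sub>E A" using PiE_mem[OF t] by (simp add: inv_into_into)
  show "compose X h ?s = t"
  proof
    fix a show "compose X h ?s a = t a"
      using PiE_mem[OF t, of a] PiE_arb[OF t, of a]
      by (cases "a \<in> X") (simp_all add: compose_def f_inv_into_f)
  qed
qed

text \<open>Function interpretations are cut down to tuples from \<open>A\<close> so that they
  remain extensional. For relations no case distinction is made: in a structure, a symbol outside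
  the vocabulary already has empty interpretation.\<close>

definition restrict_struct :: "'u vocabulary \<Rightarrow> 'u struct \<Rightarrow> 'u set \<Rightarrow> 'u struct" where
  "restrict_struct \<tau> N A = \<lparr>carrier = A,
    fun_interp = (\<lambda>f\<in>funs \<tau>. \<lambda>t \<in> fun_arity \<tau> f \<rightarrow>\<^sub>E A. fun_interp N f t),
    rel_interp = (\<lambda>R. rel_interp N R \<inter> (rel_arity \<tau> R \<rightarrow>\<^sub>E A))\<rparr>"

lemma carrier_restrict_struct [simp]: "carrier (restrict_struct \<tau> N A) = A"
  by (simp add: restrict_struct_def)

lemma substructure_restrict_struct:
  assumes "is_struct \<tau> N" "A \<subseteq> carrier N"
    and "\<And>f t. f \<in> funs \<tau> \<Longrightarrow> t \<in> fun_arity \<tau> f \<rightarrow>\<^sub>E A \<Longrightarrow> fun_interp N f t \<in> A"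
  shows "substructure \<tau> (restrict_struct \<tau> N A) N"
proof -
  have "is_struct \<tau> (restrict_struct \<tau> N A)"
    using assms(1,3) small_subset[OF is_structD(1)[OF assms(1)] assms(2)]
    by (simp add: is_struct_def restrict_struct_def)
  then show ?thesis
    using assms(1,2) by (simp add: substructure_def restrict_struct_def)
qed

text \<open>For the converse direction, tuples from the image of \<open>h\<close> lift to tuples of
  \<open>M\<close>, so the image is closed under the functions and carries a substructure of
  \<open>N\<close>. Later arguments work with this elementwise form rather than with an image
  substructure.\<close>

lemma embedding_iff:
  fixes \<tau> :: "'u vocabulary"
  shows
  "embedding \<tau> h M N \<longleftrightarrow> is_struct \<tau> M \<and> is_struct \<tau> N \<and> h \<in> carrier M \<rightarrow>\<^sub>E carrier N \<and>
    inj_on h (carrier M) \<and>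
    (\<forall>f \<in> funs \<tau>. \<forall>t \<in> fun_arity \<tau> f \<rightarrow>\<^sub>E carrier M.
      h (fun_interp M f t) = fun_interp N f (compose (fun_arity \<tau> f) h t)) \<and>
    (\<forall>R \<in> rels \<tau>. \<forall>t \<in> rel_arity \<tau> R \<rightarrow>\<^sub>E carrier M.
      t \<in> rel_interp M R \<longleftrightarrow> compose (rel_arity \<tau> R) h t \<in> rel_interp N R)" (is "_ \<longleftrightarrow> ?R")
proof
  assume "embedding \<tau> h M N"
  then obtain N' where N': "substructure \<tau> N' N" "struct_iso \<tau> h M N'"
    by (auto simp: embedding_def)
  then have b: "bij_betw h (carrier M) (carrier N')" "carrier N' \<subseteq> carrier N"
    by (auto simp: struct_iso_def substructure_def)
  then have h: "h \<in> carrier M \<rightarrow> carrier N'" by (auto simp: bij_betw_def)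
  \<comment> \<open>The interpretations in \<open>N'\<close> and \<open>N\<close> are compared only
    at tuples from \<open>N'\<close>, so tuples pushed forward along \<open>h\<close> must be known
    to lie there.\<close>
  have "compose X h t \<in> X \<rightarrow>\<^sub>E carrier N'" if "t \<in> X \<rightarrow>\<^sub>E carrier M" for X and t :: "'u \<Rightarrow> 'u"
    using compose_PiE[OF h that] .
  moreover have "h \<in> carrier M \<rightarrow>\<^sub>E carrier N"
    using N'(2) h b(2) by (auto simp: struct_iso_def PiE_def)
  ultimately show ?R
    using N' b(1) unfolding struct_iso_def substructure_def bij_betw_def by simp
next
  assume R: ?R
  define N' where "N' = restrict_struct \<tau> N (h ` carrier M)"
  have cl: "fun_interp N f t \<in> h ` carrier M"
    if f: "f \<in> funs \<tau>" and t: "t \<in> fun_arity \<tau> f \<rightarrow>\<^sub>E h ` carrier M" for f t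
  proof -
    obtain s where s: "s \<in> fun_arity \<tau> f \<rightarrow>\<^sub>E carrier M" "compose (fun_arity \<tau> f) h s = t"
      using PiE_image_lift[OF t] by blast
    have "fun_interp N f t = h (fun_interp M f s)" using R f s by auto
    then show ?thesis using is_structD(2)[OF _ f s(1)] R by auto
  qed
  have sub: "substructure \<tau> N' N"
    unfolding N'_def using R cl by (intro substructure_restrict_struct) auto
  have c: "compose X h t \<in> X \<rightarrow>\<^sub>E h ` carrier M" if "t \<in> X \<rightarrow>\<^sub>E carrier M" for X and t :: "'u \<Rightarrow> 'u"
    using that by (intro compose_PiE[where A = "carrier M"]) auto
  have "h \<in> extensional (carrier M)" using R by (auto simp: PiE_def)
  then have "struct_iso \<tau> h M N'"
    using R sub c unfolding struct_iso_def substructure_def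
    by (simp add: N'_def restrict_struct_def bij_betw_def)
  with sub show "embedding \<tau> h M N" by (auto simp: embedding_def)
qed

lemma embedding_carrier: "embedding \<tau> h M N \<Longrightarrow> x \<in> carrier M \<Longrightarrow> h x \<in> carrier N"
  by (auto simp: embedding_iff)

lemma embedding_id: "is_struct \<tau> M \<Longrightarrow> embedding \<tau> (\<lambda>x\<in>carrier M. x) M M"
  unfolding embedding_iff by (auto simp: compose_restrict_id is_structD inj_on_def)

lemma embedding_compose:
  fixes \<tau> :: "'u vocabulary"
  assumes "embedding \<tau> h M N" "embedding \<tau> g N P"
  shows "embedding \<tau> (compose (carrier M) g h) M P"
proof -
  have h: "h \<in> carrier M \<rightarrow> carrier N" and g: "g \<in> carrier N \<rightarrow> carrier P"
    and M: "is_struct \<tau> M"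
    using assms by (auto simp: embedding_iff)
  have c: "compose X h t \<in> X \<rightarrow>\<^sub>E carrier N" if "t \<in> X \<rightarrow>\<^sub>E carrier M" for X and t :: "'u \<Rightarrow> 'u"
    using compose_PiE[OF h that] .
  have "inj_on (compose (carrier M) g h) (carrier M)"
    using assms h unfolding embedding_iff by (auto simp: compose_def inj_on_def Pi_def)
  moreover have "compose (carrier M) g h \<in> carrier M \<rightarrow>\<^sub>E carrier P"
    using h g by (auto simp: compose_def)
  ultimately show ?thesis
    using assms c is_structD(2)[OF M] unfolding embedding_iff
    by (auto simp: compose_compose compose_eq)
qed

lemma embedding_inclusion:
  assumes "substructure \<tau> M N"
  shows "embedding \<tau> (\<lambda>x\<in>carrier M. x) M N"
  using assms unfolding embedding_iff substructure_def
  by (auto simp: compose_restrict_id inj_on_def) (metis is_structD(2))+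

lemma embedding_corestrict:
  fixes \<tau> :: "'u vocabulary"
  assumes "embedding \<tau> h M N" "substructure \<tau> N' N" "h ` carrier M \<subseteq> carrier N'"
  shows "embedding \<tau> h M N'"
proof -
  have h: "h \<in> carrier M \<rightarrow> carrier N'" using assms(3) by auto
  have c: "compose X h t \<in> X \<rightarrow>\<^sub>E carrier N'" if "t \<in> X \<rightarrow>\<^sub>E carrier M" for X and t :: "'u \<Rightarrow> 'u"
    using compose_PiE[OF h that] .
  moreover have "h \<in> carrier M \<rightarrow>\<^sub>E carrier N'"
    using h assms(1) by (auto simp: embedding_iff PiE_def)
  ultimately show ?thesis
    using assms(1,2) unfolding embedding_iff substructure_def by simp
qed

text \<open>Reduces closure of a class under isomorphism to closure under domains of embeddings, so
  that isomorphic copies and substructures can be treated alike.\<close>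

lemma struct_iso_inverse_embedding:
  fixes \<tau> :: "'u vocabulary"
  assumes "struct_iso \<tau> h M N"
  obtains g where "embedding \<tau> g N M"
proof -
  define g where "g = (\<lambda>y\<in>carrier N. inv_into (carrier M) h y)"
  have MN: "is_struct \<tau> M" "is_struct \<tau> N" and b: "bij_betw h (carrier M) (carrier N)"
    using assms by (auto simp: struct_iso_def)
  have gE: "g \<in> carrier N \<rightarrow>\<^sub>E carrier M"
    using b by (auto simp: g_def bij_betw_def intro!: inv_into_into)
  have hg: "h (g y) = y" if "y \<in> carrier N" for y
    using that b by (auto simp: g_def bij_betw_def f_inv_into_f)
  have gh: "g (h x) = x" if "x \<in> carrier M" for x
    using that b by (auto simp: g_def bij_betw_def)
  have c: "compose X g t \<in> X \<rightarrow>\<^sub>E carrier M" if "t \<in> X \<rightarrow>\<^sub>E carrier N" for X and t :: "'u \<Rightarrow> 'u"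
    using compose_PiE[of g, OF _ that] gE by auto
  have hc: "compose X h (compose X g t) = t" if "t \<in> X \<rightarrow>\<^sub>E carrier N" for X and t :: "'u \<Rightarrow> 'u"
    by (rule ext) (metis that hg compose_def restrict_apply PiE_mem PiE_arb)
  have "g (fun_interp N f t) = fun_interp M f (compose (fun_arity \<tau> f) g t)"
    if "f \<in> funs \<tau>" "t \<in> fun_arity \<tau> f \<rightarrow>\<^sub>E carrier N" for f t
  proof -
    have "h (fun_interp M f (compose (fun_arity \<tau> f) g t)) = fun_interp N f t"
      using assms that c hc unfolding struct_iso_def by auto
    then show ?thesis using gh is_structD(2)[OF MN(1) that(1) c[OF that(2)]] by metis
  qed
  moreover have "t \<in> rel_interp N R \<longleftrightarrow> compose (rel_arity \<tau> R) g t \<in> rel_interp M R"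
    if "R \<in> rels \<tau>" "t \<in> rel_arity \<tau> R \<rightarrow>\<^sub>E carrier N" for R t
    using assms that c hc unfolding struct_iso_def by auto
  moreover have "inj_on g (carrier N)" by (metis hg inj_onI)
  ultimately have "embedding \<tau> g N M" using MN gE by (auto simp: embedding_iff)
  then show ?thesis by (rule that)
qed

section \<open>The category of structures and embeddings\<close>

lemma AEC_cat_simps [simp]:
  "Obj (AEC_cat \<tau> L) = L" "idt (AEC_cat \<tau> L) M = (M, \<lambda>x\<in>carrier M. x, M)"
  "cmp (AEC_cat \<tau> L) (N, g, P) (M, f, N') = (M, compose (carrier M) g f, P)"
  by (simp_all add: AEC_cat_def)

lemma hom_AEC_cat:
  "hom (AEC_cat \<tau> L) M N = {(M, h, N) | h. M \<in> L \<and> N \<in> L \<and> embedding \<tau> h M N}"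
  by (auto simp: AEC_cat_def hom_def)

lemma embedding_extensional: "embedding \<tau> h M N \<Longrightarrow> h \<in> extensional (carrier M)"
  by (auto simp: embedding_iff PiE_def)

lemma category_AEC_cat:
  assumes "\<And>M. M \<in> L \<Longrightarrow> is_struct \<tau> M"
  shows "category (AEC_cat \<tau> L)"
proof
  fix X assume "X \<in> Obj (AEC_cat \<tau> L)"
  then show "idt (AEC_cat \<tau> L) X \<in> hom (AEC_cat \<tau> L) X X"
    using assms by (auto simp: hom_AEC_cat embedding_id)
next
  fix f X Y g Z assume "f \<in> hom (AEC_cat \<tau> L) X Y" "g \<in> hom (AEC_cat \<tau> L) Y Z"
  then show "cmp (AEC_cat \<tau> L) g f \<in> hom (AEC_cat \<tau> L) X Z"
    by (auto simp: hom_AEC_cat embedding_compose)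
next
  fix f X Y assume f: "f \<in> hom (AEC_cat \<tau> L) X Y"
  then obtain h where h: "f = (X, h, Y)" "embedding \<tau> h X Y" by (auto simp: hom_AEC_cat)
  then have E: "h \<in> carrier X \<rightarrow>\<^sub>E carrier Y" by (auto simp: embedding_iff)
  show "cmp (AEC_cat \<tau> L) f (idt (AEC_cat \<tau> L) X) = f"
    unfolding h(1) AEC_cat_simps
    by (intro arg_cong2[where f = Pair] refl ext) (metis E compose_def restrict_apply PiE_arb)
  show "cmp (AEC_cat \<tau> L) (idt (AEC_cat \<tau> L) Y) f = f"
    using h E by (auto simp: compose_restrict_id)
next
  fix f W X g Y h Z
  assume "f \<in> hom (AEC_cat \<tau> L) W X" "g \<in> hom (AEC_cat \<tau> L) X Y" "h \<in> hom (AEC_cat \<tau> L) Y Z"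
  then show "cmp (AEC_cat \<tau> L) h (cmp (AEC_cat \<tau> L) g f)
      = cmp (AEC_cat \<tau> L) (cmp (AEC_cat \<tau> L) h g) f"
    by (auto simp: hom_AEC_cat embedding_iff compose_compose)
qed (auto simp: AEC_cat_def)

text \<open>One index is chosen for each entry of the tuple. These are fewer than \<mu> indices, so
  they have an upper bound, and by monotonicity its set contains all entries.\<close>

lemma directed_tuple_member:
  assumes dir: "directed_poset \<mu> I r" and "|X| <o \<mu>"
    and mono: "\<And>i j. (i, j) \<in> r \<Longrightarrow> A i \<subseteq> A j" and t: "t \<in> X \<rightarrow>\<^sub>E (\<Union>i\<in>I. A i)"
  obtains i where "i \<in> I" "t \<in> X \<rightarrow>\<^sub>E A i"
proof -
  have "\<forall>x\<in>X. \<exists>i. i \<in> I \<and> t x \<in> A i" using t by (auto dest: PiE_mem)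
  then obtain \<iota> where \<iota>: "\<And>x. x \<in> X \<Longrightarrow> \<iota> x \<in> I \<and> t x \<in> A (\<iota> x)" by metis
  have "\<iota> ` X \<subseteq> I" "|\<iota> ` X| <o \<mu>"
    using \<iota> assms(2) by (auto intro: card_of_image_ordLess)
  then obtain i where i: "i \<in> I" "\<forall>j\<in>\<iota> ` X. (j, i) \<in> r"
    using directed_poset_bound[OF dir] by blast
  have "t \<in> X \<rightarrow>\<^sub>E A i"
  proof (rule PiE_I)
    fix x assume "x \<in> X"
    then show "t x \<in> A i" using \<iota> i(2) mono by blast
  qed (rule PiE_arb[OF t])
  then show ?thesis using that i(1) by blast
qed

text \<open>Two members of the system are substructures of a third one above both, so they agree on
  common tuples. Hence the member picked by \<open>SOME\<close> in \<open>struct_union\<close> does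
  not affect function values, and a relation of the union holds of a tuple from \<open>M i\<close>
  only if it holds in \<open>M i\<close>.\<close>

lemma substructure_struct_union:
  fixes M :: "'u \<Rightarrow> 'u struct"
  assumes U: "regular_universe TYPE('u)" and \<tau>: "is_vocabulary \<mu> \<tau>" and \<mu>: "regular_cardinal \<mu>"
    and dir: "directed_poset \<mu> I r"
    and M: "\<forall>i\<in>I. is_struct \<tau> (M i)" and sub: "\<forall>(i, j) \<in> r. substructure \<tau> (M i) (M j)"
    and i: "i \<in> I"
  shows "substructure \<tau> (M i) (struct_union \<tau> I M)"
proof -
  let ?C = "\<Union>i\<in>I. carrier (M i)" and ?N = "struct_union \<tau> I M"
  have mono: "carrier (M i) \<subseteq> carrier (M j)" if "(i, j) \<in> r" for i j
    using sub that by (auto simp: substructure_def)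
  have f_agree: "fun_interp (M i) f t = fun_interp (M j) f t"
    if ij: "i \<in> I" "j \<in> I" and "f \<in> funs \<tau>" "t \<in> fun_arity \<tau> f \<rightarrow>\<^sub>E carrier (M i)"
      "t \<in> fun_arity \<tau> f \<rightarrow>\<^sub>E carrier (M j)" for i j f t
  proof -
    obtain k where "(i, k) \<in> r" "(j, k) \<in> r"
      using directed_poset_bound2[OF \<mu> dir ij] by blast
    then have "substructure \<tau> (M i) (M k)" "substructure \<tau> (M j) (M k)" using sub by auto
    then show ?thesis using that by (simp add: substructure_def)
  qed
  have f_union: "fun_interp ?N f t = fun_interp (M i) f t"
    if "i \<in> I" "f \<in> funs \<tau>" "t \<in> fun_arity \<tau> f \<rightarrow>\<^sub>E carrier (M i)" for i f t
  proof -
    let ?P = "\<lambda>i. i \<in> I \<and> t \<in> fun_arity \<tau> f \<rightarrow>\<^sub>E carrier (M i)"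
    have "?P (SOME i. ?P i)" using that by (intro someI[of ?P]) auto
    then have "fun_interp (M (SOME i. ?P i)) f t = fun_interp (M i) f t"
      using that by (intro f_agree) auto
    moreover have "t \<in> fun_arity \<tau> f \<rightarrow>\<^sub>E ?C"
      using that(1,3) PiE_mono[of "fun_arity \<tau> f" "\<lambda>_. carrier (M i)" "\<lambda>_. ?C"] by (meson UN_upper subsetD)
    ultimately show ?thesis using that(2) by (simp add: struct_union_def)
  qed
  have tuple: "\<exists>i\<in>I. t \<in> X \<rightarrow>\<^sub>E carrier (M i)" if "|X| <o \<mu>" "t \<in> X \<rightarrow>\<^sub>E ?C" for X and t :: "'u \<Rightarrow> 'u"
    using directed_tuple_member[where A = "\<lambda>i. carrier (M i)", OF dir that(1) mono that(2)] by blast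
  have cN: "carrier ?N = ?C" and rN: "rel_interp ?N R = (\<Union>i\<in>I. rel_interp (M i) R)" for R
    by (simp_all add: struct_union_def)
  have N: "is_struct \<tau> ?N"
    unfolding is_struct_def cN rN
  proof (intro conjI allI ballI impI)
    show "small TYPE('u) ?C"
      using directed_posetD(1)[OF dir] M by (intro small_UNION[OF U]) (auto dest: is_structD)
    have "fun_interp ?N f t \<in> ?C" if f: "f \<in> funs \<tau>" and t: "t \<in> fun_arity \<tau> f \<rightarrow>\<^sub>E ?C" for f t
    proof -
      have "|fun_arity \<tau> f| <o \<mu>" using \<tau> f by (simp add: is_vocabulary_def)
      then obtain j where j: "j \<in> I" "t \<in> fun_arity \<tau> f \<rightarrow>\<^sub>E carrier (M j)" using tuple t by blast
      then show ?thesis using f_union[OF j(1) f j(2)] is_structD(2)[OF _ f j(2)] M by auto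
    qed
    moreover have "fun_interp ?N f t = undefined" if "f \<in> funs \<tau>" "t \<notin> fun_arity \<tau> f \<rightarrow>\<^sub>E ?C" for f t
      using that unfolding struct_union_def by simp
    moreover have "fun_interp ?N f = undefined" if "f \<notin> funs \<tau>" for f
      using that unfolding struct_union_def by simp
    ultimately show "fun_interp ?N \<in> (\<Pi>\<^sub>E f \<in> funs \<tau>. (fun_arity \<tau> f \<rightarrow>\<^sub>E ?C) \<rightarrow>\<^sub>E ?C)"
      by (intro PiE_I)
  next
    fix R assume R: "R \<in> rels \<tau>"
    show "(\<Union>i\<in>I. rel_interp (M i) R) \<subseteq> rel_arity \<tau> R \<rightarrow>\<^sub>E ?C"
    proof (rule UN_least)
      fix i assume "i \<in> I"
      then have "rel_interp (M i) R \<subseteq> rel_arity \<tau> R \<rightarrow>\<^sub>E carrier (M i)"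
        using M is_structD(3)[OF _ R] by blast
      also have "\<dots> \<subseteq> rel_arity \<tau> R \<rightarrow>\<^sub>E ?C" using \<open>i \<in> I\<close> by (intro PiE_mono) blast
      finally show "rel_interp (M i) R \<subseteq> rel_arity \<tau> R \<rightarrow>\<^sub>E ?C" .
    qed
  next
    fix R assume "R \<notin> rels \<tau>"
    then show "(\<Union>i\<in>I. rel_interp (M i) R) = {}" using M by (auto simp: is_struct_def)
  qed
  have "rel_interp (M i) R = rel_interp ?N R \<inter> (rel_arity \<tau> R \<rightarrow>\<^sub>E carrier (M i))"
    if R: "R \<in> rels \<tau>" for R
  proof
    show "rel_interp (M i) R \<subseteq> rel_interp ?N R \<inter> (rel_arity \<tau> R \<rightarrow>\<^sub>E carrier (M i))"
      using M i is_structD(3)[OF _ R] by (auto simp: rN)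
    show "rel_interp ?N R \<inter> (rel_arity \<tau> R \<rightarrow>\<^sub>E carrier (M i)) \<subseteq> rel_interp (M i) R"
    proof
      fix t assume t: "t \<in> rel_interp ?N R \<inter> (rel_arity \<tau> R \<rightarrow>\<^sub>E carrier (M i))"
      then obtain j where j: "j \<in> I" "t \<in> rel_interp (M j) R" by (auto simp: rN)
      obtain k where "(i, k) \<in> r" "(j, k) \<in> r"
        using directed_poset_bound2[OF \<mu> dir i j(1)] by blast
      then have "substructure \<tau> (M i) (M k)" "substructure \<tau> (M j) (M k)" using sub by auto
      then show "t \<in> rel_interp (M i) R" using t j R by (auto simp: substructure_def)
    qed
  qed
  moreover have "carrier (M i) \<subseteq> ?C" using i by blast
  ultimately show ?thesis
    using N M i f_union unfolding substructure_def cN by simp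
qed

section \<open>The class of structured diagrams\<close>

locale generated_category = category K for K :: "('o, 'm) cat" +
  fixes \<nu> :: "'u rel" and S :: "'o set"
  assumes universe: "regular_universe TYPE('u)"
    and \<nu>: "regular_cardinal \<nu>"
    and loc_small: "locally_small TYPE('u) K"
    and colimits: "has_directed_colimits \<nu> K"
    and all_mono: "\<forall>f \<in> Arr K. monomorphism K f"
    and S_small: "small TYPE('u) S"
    and S_Obj: "S \<subseteq> Obj K"
    and generated: "X \<in> Obj K \<Longrightarrow> directed_colimit_of \<nu> K S X"
begin

definition arrs :: "'m set" where
  "arrs = {f \<in> Arr K. src K f \<in> S \<and> trg K f \<in> S}"

text \<open>Relation symbols must be elements of \<open>'u\<close>, while arrows have type
  \<open>'m\<close>. An injection exists since \<open>arrs\<close> is small, and one is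
  fixed.\<close>

definition code :: "'m \<Rightarrow> 'u" where
  "code = (SOME c. inj_on c arrs)"

text \<open>Arities are subsets of \<open>'u\<close>, so a binary relation needs two distinct
  elements of \<open>'u\<close> as argument positions; \<open>pair\<close> then writes a pair as a
  tuple over them.\<close>

definition points :: "'u \<times> 'u" where
  "points = (SOME p. fst p \<noteq> snd p)"

definition pair :: "'u \<Rightarrow> 'u \<Rightarrow> 'u \<Rightarrow> 'u" where
  "pair x y = (\<lambda>z \<in> {fst points, snd points}. if z = fst points then x else y)"

text \<open>The function symbol \<open>\<alpha>\<close> chooses upper bounds of families indexed by the initial segment
  below \<open>\<alpha>\<close>; these segments exhaust the cardinalities below \<open>\<nu>\<close>. The relation symbol
  coding an arrow \<open>f\<close> of \<open>S\<close> holds of \<open>(x, y)\<close> when \<open>x \<le> y\<close> and the diagram takes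
  this edge to \<open>f\<close>.\<close>

definition voc :: "'u vocabulary" where
  "voc = \<lparr>funs = Field \<nu>, rels = code ` arrs, fun_arity = underS \<nu>,
    rel_arity = (\<lambda>_. {fst points, snd points})\<rparr>"

definition edge :: "'u struct \<Rightarrow> 'm \<Rightarrow> 'u \<Rightarrow> 'u \<Rightarrow> bool" where
  "edge M f x y \<longleftrightarrow> pair x y \<in> rel_interp M (code f)"

definition bounds :: "'u struct \<Rightarrow> 'u \<Rightarrow> ('u \<Rightarrow> 'u) \<Rightarrow> bool" where
  "bounds M \<alpha> t \<longleftrightarrow> (\<forall>z \<in> underS \<nu> \<alpha>. \<exists>f\<in>arrs. edge M f (t z) (fun_interp M \<alpha> t))"

text \<open>The last conjunct of \<open>diagram_axioms\<close> says, all arrows being monic, that distinct elements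
  have distinct colimit legs; it makes the colimit functor faithful.\<close>

definition diagram_axioms :: "'u struct \<Rightarrow> 'u \<Rightarrow> 'u \<Rightarrow> 'u \<Rightarrow> bool" where
  "diagram_axioms M x y z \<longleftrightarrow>
    (\<exists>s\<in>S. edge M (idt K s) x x) \<and>
    (\<forall>f\<in>arrs. \<forall>g\<in>arrs. edge M f x y \<longrightarrow> edge M g y z \<longrightarrow>
      trg K f = src K g \<and> edge M (cmp K g f) x z) \<and>
    (\<forall>f\<in>arrs. \<forall>g\<in>arrs. edge M f x y \<longrightarrow> edge M g x y \<longrightarrow> f = g) \<and>
    (\<forall>f\<in>arrs. \<forall>g\<in>arrs. edge M f x y \<longrightarrow> edge M g y x \<longrightarrow> x = y) \<and>
    (\<forall>f\<in>arrs. edge M f x z \<longrightarrow> edge M f y z \<longrightarrow> x = y)"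

text \<open>Elements of the structure are quantified only universally: the existential quantifiers
  inside the conditions range over \<open>S\<close> and \<open>arrs\<close>. This is what makes the
  class closed under substructures.\<close>

definition diagrams :: "'u struct set" where
  "diagrams = {M. is_struct voc M \<and>
    (\<forall>x\<in>carrier M. \<forall>y\<in>carrier M. \<forall>z\<in>carrier M. diagram_axioms M x y z) \<and>
    (\<forall>\<alpha>\<in>Field \<nu>. \<forall>t \<in> underS \<nu> \<alpha> \<rightarrow>\<^sub>E carrier M. bounds M \<alpha> t)}"

lemma voc_simps [simp]: "funs voc = Field \<nu>" "rels voc = code ` arrs" "fun_arity voc = underS \<nu>"
    "rel_arity voc R = {fst points, snd points}"
  by (simp_all add: voc_def)

section \<open>Smallness of the vocabulary and coding of pairs\<close>

lemma arrs_small: "small TYPE('u) arrs"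
proof -
  have "small TYPE('u) (\<Union>s\<in>S. \<Union>s'\<in>S. hom K s s')"
    using S_small S_Obj loc_small
    by (intro small_UNION[OF universe]) (auto simp: locally_small_def)
  then show ?thesis by (rule small_subset) (auto simp: arrs_def hom_def)
qed

lemma inj_code: "inj_on code arrs"
proof -
  have "|arrs| \<le>o |UNIV :: 'u set|"
    using arrs_small by (simp add: small_def ordLess_imp_ordLeq)
  then obtain c :: "'m \<Rightarrow> 'u" where "inj_on c arrs"
    using card_of_ordLeq[of arrs "UNIV :: 'u set"] by blast
  then show ?thesis unfolding code_def by (rule someI[where P = "\<lambda>c. inj_on c arrs"])
qed

lemma points_distinct: "fst points \<noteq> snd points"
proof -
  have "infinite (UNIV :: 'u set)" using universe by (simp add: regular_universe_def)
  then obtain a b :: 'u where "a \<noteq> b"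
    by (metis ex_new_if_finite finite.emptyI finite_insert insertI1)
  then have "fst (a, b) \<noteq> snd (a, b)" by simp
  then show ?thesis unfolding points_def by (rule someI[where P = "\<lambda>p. fst p \<noteq> snd p"])
qed

lemma pair_apply: "pair x y (fst points) = x" "pair x y (snd points) = y"
  using points_distinct by (simp_all add: pair_def)

lemma pair_PiE: "pair x y \<in> {fst points, snd points} \<rightarrow>\<^sub>E A \<longleftrightarrow> x \<in> A \<and> y \<in> A"
proof
  assume a: "pair x y \<in> {fst points, snd points} \<rightarrow>\<^sub>E A"
  show "x \<in> A \<and> y \<in> A"
    using PiE_mem[OF a, of "fst points"] PiE_mem[OF a, of "snd points"] by (simp add: pair_apply)
next
  assume "x \<in> A \<and> y \<in> A"
  then show "pair x y \<in> {fst points, snd points} \<rightarrow>\<^sub>E A" by (simp add: pair_def)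
qed

lemma compose_pair: "compose {fst points, snd points} h (pair x y) = pair (h x) (h y)"
  unfolding compose_def pair_def by (intro restrict_ext) auto

lemma pair_eq_iff: "pair x y = pair x' y' \<longleftrightarrow> x = x' \<and> y = y'"
  by (metis pair_apply)

lemma is_vocabulary_voc: "is_vocabulary \<nu> voc"
proof -
  have "|Field \<nu>| <o |UNIV :: 'u set|"
    using \<nu> card_of_Field_ordIso ordIso_ordLess_trans unfolding regular_cardinal_def by blast
  moreover have "|code ` arrs| <o |UNIV :: 'u set|"
    using arrs_small unfolding small_def by (rule card_of_image_ordLess)
  ultimately show ?thesis
    by (simp add: is_vocabulary_def small_def regular_cardinal_underS[OF \<nu>]
        regular_cardinal_finite[OF \<nu>])
qed

lemma arrs_hom: "f \<in> arrs \<Longrightarrow> f \<in> hom K (src K f) (trg K f)"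
  by (simp add: arrs_def hom_def)

lemma hom_arrs: "f \<in> hom K s s' \<Longrightarrow> s \<in> S \<Longrightarrow> s' \<in> S \<Longrightarrow> f \<in> arrs"
  by (simp add: arrs_def hom_def)

lemma idt_arrs: "s \<in> S \<Longrightarrow> idt K s \<in> arrs"
  using idt_hom S_Obj hom_arrs by blast

lemma cmp_arrs: "f \<in> arrs \<Longrightarrow> g \<in> arrs \<Longrightarrow> trg K f = src K g \<Longrightarrow> cmp K g f \<in> arrs"
  using cmp_hom[of f "src K f" "trg K f" g "trg K g"] by (auto simp: arrs_def hom_def)

section \<open>Edges and axioms under embeddings\<close>

lemma edge_carrier:
  assumes "is_struct voc M" "f \<in> arrs" "edge M f x y"
  shows "x \<in> carrier M" "y \<in> carrier M"
  using is_structD(3)[OF assms(1), of "code f" "pair x y"] assms(2,3)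
  by (simp_all add: edge_def pair_PiE)

lemma edge_embedding:
  assumes "embedding voc h M N" "f \<in> arrs" "x \<in> carrier M" "y \<in> carrier M"
  shows "edge M f x y \<longleftrightarrow> edge N f (h x) (h y)"
proof -
  have "pair x y \<in> {fst points, snd points} \<rightarrow>\<^sub>E carrier M" using assms by (simp add: pair_PiE)
  then show ?thesis
    using assms(1,2) unfolding embedding_iff edge_def by (simp add: compose_pair)
qed

text \<open>The axioms are built, without quantifiers over elements, from equalities and edges, both
  of which embeddings preserve and reflect.\<close>

lemma diagram_axioms_embedding:
  assumes h: "embedding voc h M N" and x: "x \<in> carrier M" "y \<in> carrier M" "z \<in> carrier M"
  shows "diagram_axioms M x y z \<longleftrightarrow> diagram_axioms N (h x) (h y) (h z)"
proof -
  have inj: "h a = h b \<longleftrightarrow> a = b" if "a \<in> carrier M" "b \<in> carrier M" for a b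
    using h that unfolding embedding_iff by (auto dest: inj_onD)
  note e = edge_embedding[OF h]
  \<comment> \<open>\<open>edge_embedding\<close> applies only to members of \<open>arrs\<close>,
    and the composite is known to be one only when the endpoints match; so the two conjuncts are
    transferred together.\<close>
  have c: "(trg K f = src K g \<and> edge M (cmp K g f) x z) \<longleftrightarrow>
      (trg K f = src K g \<and> edge N (cmp K g f) (h x) (h z))" if "f \<in> arrs" "g \<in> arrs" for f g
    using e[of "cmp K g f" x z] cmp_arrs[OF that] x by blast
  show ?thesis
    unfolding diagram_axioms_def using x by (simp add: e inj c idt_arrs cong: bex_cong ball_cong)
qed

lemma bounds_embedding:
  assumes h: "embedding voc h M N" and \<alpha>: "\<alpha> \<in> Field \<nu>" and t: "t \<in> underS \<nu> \<alpha> \<rightarrow>\<^sub>E carrier M"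
  shows "bounds M \<alpha> t \<longleftrightarrow> bounds N \<alpha> (compose (underS \<nu> \<alpha>) h t)"
proof -
  have M: "is_struct voc M" using h by (simp add: embedding_iff)
  have "h (fun_interp M \<alpha> t) = fun_interp N \<alpha> (compose (underS \<nu> \<alpha>) h t)"
    using h \<alpha> t by (simp add: embedding_iff)
  moreover have "fun_interp M \<alpha> t \<in> carrier M" using is_structD(2)[OF M] \<alpha> t by simp
  ultimately show ?thesis
    unfolding bounds_def using edge_embedding[OF h] PiE_mem[OF t]
    by (simp add: compose_def cong: ball_cong bex_cong)
qed

lemma diagrams_struct: "M \<in> diagrams \<Longrightarrow> is_struct voc M"
  by (simp add: diagrams_def)

text \<open>Pulling the conditions back along an embedding handles substructures, via their
  inclusion, and isomorphic copies, via the inverse, at once.\<close>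

lemma diagrams_embedding:
  assumes h: "embedding voc h M N" and N: "N \<in> diagrams"
  shows "M \<in> diagrams"
proof -
  have hE: "h \<in> carrier M \<rightarrow> carrier N" and M: "is_struct voc M"
    using h by (auto simp: embedding_iff)
  have "diagram_axioms M x y z" if "x \<in> carrier M" "y \<in> carrier M" "z \<in> carrier M" for x y z
    using diagram_axioms_embedding[OF h that] N funcset_mem[OF hE] that by (simp add: diagrams_def)
  moreover have "bounds M \<alpha> t" if "\<alpha> \<in> Field \<nu>" "t \<in> underS \<nu> \<alpha> \<rightarrow>\<^sub>E carrier M" for \<alpha> t
    using bounds_embedding[OF h that] compose_PiE[OF hE that(2)] N that(1) by (simp add: diagrams_def)
  ultimately show ?thesis using M by (simp add: diagrams_def)
qed

text \<open>For unions, each axiom involves three elements and each bound a tuple indexed by fewer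
  than \<nu> positions. By directedness these lie in one member, where the condition holds, and it
  transfers along the inclusion.\<close>

lemma universal_AEC_diagrams: "universal_AEC \<nu> voc diagrams"
  unfolding universal_AEC_def
proof (intro conjI ballI allI impI)
  show "is_vocabulary \<nu> voc" by (rule is_vocabulary_voc)
  show "is_struct voc M" if "M \<in> diagrams" for M using that by (rule diagrams_struct)
  show "N \<in> diagrams" if "M \<in> diagrams" "struct_iso voc h M N" for M N h
    using struct_iso_inverse_embedding[OF that(2)] diagrams_embedding[OF _ that(1)] by metis
  show "M \<in> diagrams" if "N \<in> diagrams" "substructure voc M N" for M N
    using diagrams_embedding[OF embedding_inclusion[OF that(2)] that(1)] .
next
  fix I r M
  assume dir: "directed_poset \<nu> I r" and M: "\<forall>i\<in>I. M i \<in> diagrams"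
    and sub: "\<forall>(i, j)\<in>r. substructure voc (M i) (M j)"
  let ?N = "struct_union voc I M"
  have subN: "substructure voc (M i) ?N" if "i \<in> I" for i
    using substructure_struct_union[OF universe is_vocabulary_voc \<nu> dir _ sub that] M
    by (simp add: diagrams_struct)
  then have emb: "embedding voc (\<lambda>x\<in>carrier (M i). x) (M i) ?N" if "i \<in> I" for i
    using that embedding_inclusion by blast
  have cN: "carrier ?N = (\<Union>i\<in>I. carrier (M i))" by (simp add: struct_union_def)
  have mono: "carrier (M i) \<subseteq> carrier (M j)" if "(i, j) \<in> r" for i j
    using sub that by (auto simp: substructure_def)
  have ax: "diagram_axioms ?N x y z"
    if xyz: "x \<in> carrier ?N" "y \<in> carrier ?N" "z \<in> carrier ?N" for x y z
  proof -
    obtain i j k where ijk: "i \<in> I" "j \<in> I" "k \<in> I"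
      "x \<in> carrier (M i)" "y \<in> carrier (M j)" "z \<in> carrier (M k)"
      using xyz unfolding cN by blast
    obtain l where l: "l \<in> I" "\<forall>a\<in>{i, j, k}. (a, l) \<in> r"
      using directed_poset_bound[OF dir, of "{i, j, k}"] ijk regular_cardinal_finite[OF \<nu>, of "{i, j, k}"]
      by blast
    have m: "x \<in> carrier (M l)" "y \<in> carrier (M l)" "z \<in> carrier (M l)"
      using l(2) mono ijk by blast+
    have "diagram_axioms (M l) x y z" using M l(1) m by (simp add: diagrams_def)
    then show ?thesis using diagram_axioms_embedding[OF emb[OF l(1)] m] m by simp
  qed
  have bd: "bounds ?N \<alpha> t" if \<alpha>: "\<alpha> \<in> Field \<nu>" and t: "t \<in> underS \<nu> \<alpha> \<rightarrow>\<^sub>E carrier ?N" for \<alpha> t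
  proof -
    obtain i where i: "i \<in> I" "t \<in> underS \<nu> \<alpha> \<rightarrow>\<^sub>E carrier (M i)"
      using directed_tuple_member[where A = "\<lambda>i. carrier (M i)",
          OF dir regular_cardinal_underS[OF \<nu> \<alpha>] mono t[unfolded cN]] by blast
    then have "bounds (M i) \<alpha> t" using M \<alpha> by (simp add: diagrams_def)
    then show ?thesis
      using bounds_embedding[OF emb[OF i(1)] \<alpha> i(2)] compose_restrict_id[OF i(2)] by simp
  qed
  obtain i where "i \<in> I" using directed_poset_nonempty[OF \<nu> dir] by blast
  then have "is_struct voc ?N" using subN by (auto simp: substructure_def)
  with ax bd show "?N \<in> diagrams" by (simp add: diagrams_def)
qed

section \<open>The directed diagram recorded by a structure\<close>

definition sort :: "'u struct \<Rightarrow> 'u \<Rightarrow> 'o" where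
  "sort M x = (THE s. s \<in> S \<and> edge M (idt K s) x x)"

definition order :: "'u struct \<Rightarrow> 'u rel" where
  "order M = {(x, y). \<exists>f\<in>arrs. edge M f x y}"

definition diagram :: "'u struct \<Rightarrow> ('u, 'u \<times> 'u, 'o, 'm) fnctr" where
  "diagram M = \<lparr>omap = sort M, amap = (\<lambda>(x, y). THE f. f \<in> arrs \<and> edge M f x y)\<rparr>"

lemma diagramsD:
  assumes "M \<in> diagrams"
  shows "x \<in> carrier M \<Longrightarrow> \<exists>s\<in>S. edge M (idt K s) x x"
    "f \<in> arrs \<Longrightarrow> g \<in> arrs \<Longrightarrow> edge M f x y \<Longrightarrow> edge M g y z \<Longrightarrow>
      trg K f = src K g \<and> edge M (cmp K g f) x z"
    "f \<in> arrs \<Longrightarrow> g \<in> arrs \<Longrightarrow> edge M f x y \<Longrightarrow> edge M g x y \<Longrightarrow> f = g"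
    "f \<in> arrs \<Longrightarrow> g \<in> arrs \<Longrightarrow> edge M f x y \<Longrightarrow> edge M g y x \<Longrightarrow> x = y"
    "f \<in> arrs \<Longrightarrow> edge M f x z \<Longrightarrow> edge M f y z \<Longrightarrow> x = y"
proof -
  note M = diagrams_struct[OF assms]
  have ax: "diagram_axioms M x y z" if "x \<in> carrier M" "y \<in> carrier M" "z \<in> carrier M" for x y z
    using assms that by (simp add: diagrams_def)
  show "\<exists>s\<in>S. edge M (idt K s) x x" if "x \<in> carrier M"
    using ax[OF that that that] by (simp add: diagram_axioms_def)
  show "trg K f = src K g \<and> edge M (cmp K g f) x z"
    if "f \<in> arrs" "g \<in> arrs" "edge M f x y" "edge M g y z"
    using ax[of x y z] edge_carrier[OF M] that by (simp add: diagram_axioms_def)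
  show "f = g" if "f \<in> arrs" "g \<in> arrs" "edge M f x y" "edge M g x y"
    using ax[of x y x] edge_carrier[OF M] that by (simp add: diagram_axioms_def)
  show "x = y" if "f \<in> arrs" "g \<in> arrs" "edge M f x y" "edge M g y x"
    using ax[of x y x] edge_carrier[OF M] that unfolding diagram_axioms_def by blast
  show "x = y" if "f \<in> arrs" "edge M f x z" "edge M f y z"
    using ax[of x y z] edge_carrier[OF M] that unfolding diagram_axioms_def by blast
qed

text \<open>Parallel edges carry the same arrow, so two identity loops at \<open>x\<close> coincide,
  and an identity arrow determines its object.\<close>

lemma sort_eq:
  assumes "M \<in> diagrams" "s \<in> S" "edge M (idt K s) x x"
  shows "sort M x = s"
  unfolding sort_def
proof (rule the_equality)
  fix s' assume s': "s' \<in> S \<and> edge M (idt K s') x x"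
  then have "idt K s' = idt K s"
    using diagramsD(3)[OF assms(1)] assms(2,3) idt_arrs by blast
  then show "s' = s" using idt_hom s' assms(2) S_Obj by (metis homD subsetD)
qed (use assms in simp)

lemma sort_S:
  assumes "M \<in> diagrams" "x \<in> carrier M"
  shows "sort M x \<in> S" "edge M (idt K (sort M x)) x x"
  using diagramsD(1)[OF assms] sort_eq[OF assms(1)] by auto

text \<open>The identity edges at \<open>x\<close> and \<open>y\<close> are adjacent to the edge
  \<open>f\<close>, so the composability clause of the axioms fixes the source and the target of
  \<open>f\<close>.\<close>

lemma edge_hom:
  assumes M: "M \<in> diagrams" and f: "f \<in> arrs" "edge M f x y"
  shows "f \<in> hom K (sort M x) (sort M y)"
proof -
  note c = edge_carrier[OF diagrams_struct[OF M] f]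
  note sx = sort_S[OF M c(1)] and sy = sort_S[OF M c(2)]
  have "trg K (idt K (sort M x)) = src K f"
    using diagramsD(2)[OF M idt_arrs[OF sx(1)] f(1) sx(2) f(2)] by simp
  moreover have "trg K f = src K (idt K (sort M y))"
    using diagramsD(2)[OF M f(1) idt_arrs[OF sy(1)] f(2) sy(2)] by simp
  moreover have "idt K (sort M x) \<in> hom K (sort M x) (sort M x)"
      "idt K (sort M y) \<in> hom K (sort M y) (sort M y)"
    using sx(1) sy(1) S_Obj idt_hom by blast+
  ultimately show ?thesis using arrs_hom[OF f(1)] homD by metis
qed

lemma omap_diagram [simp]: "omap (diagram M) = sort M"
  by (simp add: diagram_def)

lemma amap_diagram:
  assumes M: "M \<in> diagrams" and f: "f \<in> arrs" "edge M f x y"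
  shows "amap (diagram M) (x, y) = f"
proof -
  have "(THE f. f \<in> arrs \<and> edge M f x y) = f"
  proof (rule the_equality)
    show "g = f" if "g \<in> arrs \<and> edge M g x y" for g
      using diagramsD(3)[OF M _ f(1) _ f(2)] that by blast
  qed (use f in simp)
  then show ?thesis by (simp add: diagram_def)
qed

lemma orderE:
  assumes "M \<in> diagrams" "(x, y) \<in> order M"
  obtains f where "f \<in> arrs" "edge M f x y" "amap (diagram M) (x, y) = f"
    "f \<in> hom K (sort M x) (sort M y)" "x \<in> carrier M" "y \<in> carrier M"
proof -
  obtain f where f: "f \<in> arrs" "edge M f x y" using assms(2) by (auto simp: order_def)
  show ?thesis
    using that[OF f amap_diagram[OF assms(1) f] edge_hom[OF assms(1) f]
        edge_carrier[OF diagrams_struct[OF assms(1)] f]] .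
qed

text \<open>A subset with fewer than \<nu> elements is enumerated by some
  \<open>underS \<nu> \<alpha>\<close>, and the function symbol \<alpha> applied to this enumeration
  yields an upper bound.\<close>

lemma directed_order:
  assumes M: "M \<in> diagrams"
  shows "directed_poset \<nu> (carrier M) (order M)"
  unfolding directed_poset_def
proof (intro conjI allI impI)
  show "small TYPE('u) (carrier M)" using is_structD(1)[OF diagrams_struct[OF M]] .
  have "refl_on (carrier M) (order M)"
    unfolding refl_on_def order_def using sort_S[OF M] idt_arrs by blast
  moreover have "trans (order M)"
  proof (rule transI)
    fix x y z assume xy: "(x, y) \<in> order M" and yz: "(y, z) \<in> order M"
    obtain f where f: "f \<in> arrs" "edge M f x y" using xy by (auto simp: order_def)
    obtain g where g: "g \<in> arrs" "edge M g y z" using yz by (auto simp: order_def)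
    show "(x, z) \<in> order M"
      using diagramsD(2)[OF M f(1) g(1) f(2) g(2)] cmp_arrs[OF f(1) g(1)] by (auto simp: order_def)
  qed
  moreover have "antisym (order M)"
    unfolding antisym_def order_def using diagramsD(4)[OF M] by blast
  moreover have "order M \<subseteq> carrier M \<times> carrier M"
    unfolding order_def using edge_carrier[OF diagrams_struct[OF M]] by blast
  ultimately show "partial_order_on (carrier M) (order M)" by (simp add: order_on_defs)
next
  fix X assume X: "X \<subseteq> carrier M" "|X| <o \<nu>"
  obtain \<alpha> g where \<alpha>: "\<alpha> \<in> Field \<nu>" and g: "bij_betw g (underS \<nu> \<alpha>) X"
    using ordLess_enumerate[OF regular_cardinal_Well_order[OF \<nu>] X(2)] by metis
  define t where "t = restrict g (underS \<nu> \<alpha>)"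
  have t: "t \<in> underS \<nu> \<alpha> \<rightarrow>\<^sub>E carrier M"
    unfolding t_def using g X(1) by (auto simp: bij_betw_def)
  have "bounds M \<alpha> t" using M \<alpha> t by (simp add: diagrams_def)
  then have "(x, fun_interp M \<alpha> t) \<in> order M" if "x \<in> X" for x
    using that g unfolding bounds_def order_def t_def by (auto simp: bij_betw_def)
  moreover have "fun_interp M \<alpha> t \<in> carrier M"
    using is_structD(2)[OF diagrams_struct[OF M]] \<alpha> t by simp
  ultimately show "\<exists>b\<in>carrier M. \<forall>x\<in>X. (x, b) \<in> order M" by blast
qed

lemma is_functor_diagram:
  assumes M: "M \<in> diagrams"
  shows "is_functor (poset_cat (carrier M) (order M)) K (diagram M)"
  unfolding is_functor_poset_cat
proof (intro conjI ballI allI impI)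
  show "category (poset_cat (carrier M) (order M))"
    using category_poset_cat directed_posetD(2)[OF directed_order[OF M]] by blast
  show "category K" by unfold_locales
  show "omap (diagram M) x \<in> Obj K" if "x \<in> carrier M" for x
    using sort_S(1)[OF M that] S_Obj by auto
  show "case p of (x, y) \<Rightarrow> amap (diagram M) (x, y) \<in> hom K (omap (diagram M) x) (omap (diagram M) y)"
    if "p \<in> order M" for p
    using that by (cases p) (auto elim: orderE[OF M])
  show "amap (diagram M) (x, x) = idt K (omap (diagram M) x)" if "x \<in> carrier M" for x
    using amap_diagram[OF M idt_arrs] sort_S[OF M that] by simp
next
  fix x y z assume xy: "(x, y) \<in> order M" and yz: "(y, z) \<in> order M"
  obtain f where f: "f \<in> arrs" "edge M f x y" "amap (diagram M) (x, y) = f"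
    using orderE[OF M xy] by metis
  obtain g where g: "g \<in> arrs" "edge M g y z" "amap (diagram M) (y, z) = g"
    using orderE[OF M yz] by metis
  have "trg K f = src K g" "edge M (cmp K g f) x z"
    using diagramsD(2)[OF M f(1) g(1) f(2) g(2)] by auto
  then show "amap (diagram M) (x, z) = cmp K (amap (diagram M) (y, z)) (amap (diagram M) (x, y))"
    using amap_diagram[OF M cmp_arrs[OF f(1) g(1)]] f(3) g(3) by simp
qed

end

section \<open>The colimit functor\<close>

lemma is_cocone_functor_comp:
  assumes "is_functor C D F" "is_functor J C G" "is_cocone J C G X c"
  shows "is_cocone J D (functor_comp F G) (omap F X) (\<lambda>i. amap F (c i))"
  unfolding is_cocone_def
proof (intro conjI ballI allI)
  interpret F: is_functor C D F by fact
  interpret G: is_functor J C G by fact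
  have c: "X \<in> Obj C" "\<And>i. i \<in> Obj J \<Longrightarrow> c i \<in> hom C (omap G i) X"
      "\<And>i j e. e \<in> hom J i j \<Longrightarrow> cmp C (c j) (amap G e) = c i"
    using assms(3) by (auto simp: is_cocone_def)
  show "omap F X \<in> Obj D" using F.omap_Obj c(1) .
  show "amap F (c i) \<in> hom D (omap (functor_comp F G) i) (omap F X)" if "i \<in> Obj J" for i
    using F.amap_hom[OF c(2)[OF that]] by (simp add: functor_comp_def)
  show "cmp D (amap F (c j)) (amap (functor_comp F G) e) = amap F (c i)" if e: "e \<in> hom J i j" for i j e
  proof -
    have "j \<in> Obj J" using G.C.homD[OF e] by simp
    then show ?thesis
      using F.amap_cmp[OF G.amap_hom[OF e] c(2)] c(3)[OF e] by (simp add: functor_comp_def)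
  qed
qed

context generated_category
begin

abbreviation shape :: "'u struct \<Rightarrow> ('u, 'u \<times> 'u) cat" where
  "shape M \<equiv> poset_cat (carrier M) (order M)"

definition colim :: "'u struct \<Rightarrow> 'o \<times> ('u \<Rightarrow> 'm)" where
  "colim M = (SOME p. is_colimit (shape M) K (diagram M) (fst p) (snd p))"

abbreviation apex :: "'u struct \<Rightarrow> 'o" where
  "apex M \<equiv> fst (colim M)"

abbreviation leg :: "'u struct \<Rightarrow> 'u \<Rightarrow> 'm" where
  "leg M \<equiv> snd (colim M)"

text \<open>Phrasing compatibility in terms of the edges themselves keeps the description operator
  in \<open>diagram\<close> out of later arguments.\<close>

lemma is_cocone_diagram_iff:
  assumes M: "M \<in> diagrams"
  shows "is_cocone (shape M) K (diagram M) Y d \<longleftrightarrow> Y \<in> Obj K \<and>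
    (\<forall>x\<in>carrier M. d x \<in> hom K (sort M x) Y) \<and>
    (\<forall>f\<in>arrs. \<forall>x y. edge M f x y \<longrightarrow> cmp K (d y) f = d x)"
proof -
  have "(\<forall>(x, y)\<in>order M. cmp K (d y) (amap (diagram M) (x, y)) = d x) \<longleftrightarrow>
      (\<forall>f\<in>arrs. \<forall>x y. edge M f x y \<longrightarrow> cmp K (d y) f = d x)"
  proof (intro iffI ballI allI impI)
    fix f x y assume "\<forall>(x, y)\<in>order M. cmp K (d y) (amap (diagram M) (x, y)) = d x"
      and f: "f \<in> arrs" "edge M f x y"
    then have "cmp K (d y) (amap (diagram M) (x, y)) = d x" by (auto simp: order_def)
    then show "cmp K (d y) f = d x" using amap_diagram[OF M f] by simp
  next
    fix p assume d: "\<forall>f\<in>arrs. \<forall>x y. edge M f x y \<longrightarrow> cmp K (d y) f = d x" and p: "p \<in> order M"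
    obtain x y where xy: "p = (x, y)" by (cases p)
    obtain f where f: "f \<in> arrs" "edge M f x y" using p xy by (auto simp: order_def)
    show "case p of (x, y) \<Rightarrow> cmp K (d y) (amap (diagram M) (x, y)) = d x"
      using d f amap_diagram[OF M f] by (simp add: xy)
  qed
  then show ?thesis unfolding is_cocone_poset_cat by simp
qed

lemma is_colimit_colim:
  assumes M: "M \<in> diagrams"
  shows "is_colimit (shape M) K (diagram M) (apex M) (leg M)"
proof -
  obtain X c where "is_colimit (shape M) K (diagram M) X c"
    using colimits directed_order[OF M] is_functor_diagram[OF M]
    unfolding has_directed_colimits_def by blast
  then have "is_colimit (shape M) K (diagram M) (fst (X, c)) (snd (X, c))" by simp
  then show ?thesis unfolding colim_def
    by (rule someI[where P = "\<lambda>p. is_colimit (shape M) K (diagram M) (fst p) (snd p)"])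
qed

lemma leg:
  assumes M: "M \<in> diagrams"
  shows "apex M \<in> Obj K" "x \<in> carrier M \<Longrightarrow> leg M x \<in> hom K (sort M x) (apex M)"
    "f \<in> arrs \<Longrightarrow> edge M f x y \<Longrightarrow> cmp K (leg M y) f = leg M x"
proof -
  have "is_cocone (shape M) K (diagram M) (apex M) (leg M)"
    using is_colimit_colim[OF M] by (simp add: is_colimit_def)
  then show "apex M \<in> Obj K" "x \<in> carrier M \<Longrightarrow> leg M x \<in> hom K (sort M x) (apex M)"
    "f \<in> arrs \<Longrightarrow> edge M f x y \<Longrightarrow> cmp K (leg M y) f = leg M x"
    using is_cocone_diagram_iff[OF M] by auto
qed

lemma is_cocone_postcompose:
  assumes M: "M \<in> diagrams" and k: "k \<in> hom K (apex M) Y"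
  shows "is_cocone (shape M) K (diagram M) Y (\<lambda>x. cmp K k (leg M x))"
  unfolding is_cocone_diagram_iff[OF M]
proof (intro conjI ballI allI impI)
  show "Y \<in> Obj K" using homD[OF k] by simp
  show "cmp K k (leg M x) \<in> hom K (sort M x) Y" if "x \<in> carrier M" for x
    using cmp_hom[OF leg(2)[OF M that] k] .
  show "cmp K (cmp K k (leg M y)) f = cmp K k (leg M x)" if f: "f \<in> arrs" "edge M f x y" for f x y
  proof -
    have "y \<in> carrier M" using edge_carrier[OF diagrams_struct[OF M] f] by simp
    then show ?thesis
      using cmp_assoc[OF edge_hom[OF M f] leg(2)[OF M] k] leg(3)[OF M f] by simp
  qed
qed

text \<open>The legs of a colimit are jointly epic: both arrows mediate the cocone obtained by
  composing \<open>k'\<close> with the legs.\<close>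

lemma apex_hom_eq:
  assumes M: "M \<in> diagrams" and k: "k \<in> hom K (apex M) Y" "k' \<in> hom K (apex M) Y"
    and eq: "\<And>x. x \<in> carrier M \<Longrightarrow> cmp K k (leg M x) = cmp K k' (leg M x)"
  shows "k = k'"
  by (rule colimit_eq[OF is_colimit_colim[OF M] is_cocone_postcompose[OF M k(2)] k])
    (use eq in auto)

definition colim_functor ::
    "('u struct, 'u struct \<times> ('u \<Rightarrow> 'u) \<times> 'u struct, 'o, 'm) fnctr" where
  "colim_functor = \<lparr>omap = apex, amap = (\<lambda>(M, h, N). THE k. k \<in> hom K (apex M) (apex N) \<and>
      (\<forall>x\<in>carrier M. cmp K k (leg M x) = leg N (h x)))\<rparr>"

lemma omap_colim_functor [simp]: "omap colim_functor = apex"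
  by (simp add: colim_functor_def)

lemma sort_embedding:
  assumes "M \<in> diagrams" "N \<in> diagrams" "embedding voc h M N" "x \<in> carrier M"
  shows "sort N (h x) = sort M x"
  using sort_S[OF assms(1,4)] edge_embedding[OF assms(3) _ assms(4,4)] idt_arrs
  by (intro sort_eq[OF assms(2)]) auto

lemma amap_colim_functor_eq:
  assumes M: "M \<in> diagrams" and k: "k \<in> hom K (apex M) (apex N)"
    and eq: "\<And>x. x \<in> carrier M \<Longrightarrow> cmp K k (leg M x) = leg N (h x)"
  shows "amap colim_functor (M, h, N) = k"
proof -
  have "(THE k. k \<in> hom K (apex M) (apex N) \<and>
      (\<forall>x\<in>carrier M. cmp K k (leg M x) = leg N (h x))) = k"
  proof (rule the_equality)
    fix k' assume "k' \<in> hom K (apex M) (apex N) \<and> (\<forall>x\<in>carrier M. cmp K k' (leg M x) = leg N (h x))"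
    then show "k' = k" using apex_hom_eq[OF M _ k] eq by simp
  qed (use k eq in simp)
  then show ?thesis by (simp add: colim_functor_def)
qed

text \<open>Embeddings preserve edges and sorts, so the legs of \<open>N\<close> at the points
  \<open>h x\<close> form a cocone over the diagram of \<open>M\<close>; the functor takes the
  induced arrow.\<close>

lemma amap_colim_functor:
  assumes M: "M \<in> diagrams" and N: "N \<in> diagrams" and h: "embedding voc h M N"
  shows "amap colim_functor (M, h, N) \<in> hom K (apex M) (apex N)"
    "x \<in> carrier M \<Longrightarrow> cmp K (amap colim_functor (M, h, N)) (leg M x) = leg N (h x)"
proof -
  have "is_cocone (shape M) K (diagram M) (apex N) (\<lambda>x. leg N (h x))"
    unfolding is_cocone_diagram_iff[OF M]
  proof (intro conjI ballI allI impI)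
    show "apex N \<in> Obj K" using leg(1)[OF N] .
    show "leg N (h x) \<in> hom K (sort M x) (apex N)" if "x \<in> carrier M" for x
      using leg(2)[OF N embedding_carrier[OF h that]] sort_embedding[OF M N h that] by simp
    show "cmp K (leg N (h y)) f = leg N (h x)" if f: "f \<in> arrs" "edge M f x y" for f x y
      using leg(3)[OF N f(1)] edge_embedding[OF h f(1)]
        edge_carrier[OF diagrams_struct[OF M] f] f(2) by simp
  qed
  then obtain k where k: "k \<in> hom K (apex M) (apex N)"
      "\<And>x. x \<in> carrier M \<Longrightarrow> cmp K k (leg M x) = leg N (h x)"
    using colimit_desc[OF is_colimit_colim[OF M]] unfolding poset_cat_simps(1) by blast
  have "amap colim_functor (M, h, N) = k" using amap_colim_functor_eq[OF M k] .
  then show "amap colim_functor (M, h, N) \<in> hom K (apex M) (apex N)"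
    "x \<in> carrier M \<Longrightarrow> cmp K (amap colim_functor (M, h, N)) (leg M x) = leg N (h x)"
    using k by simp_all
qed

lemma is_functor_colim_functor: "is_functor (AEC_cat voc diagrams) K colim_functor"
proof -
  interpret A: category "AEC_cat voc diagrams"
    using category_AEC_cat diagrams_struct by blast
  show ?thesis
  proof
    show "omap colim_functor M \<in> Obj K" if "M \<in> Obj (AEC_cat voc diagrams)" for M
      using that leg(1) by simp
    show "amap colim_functor f \<in> hom K (omap colim_functor M) (omap colim_functor N)"
      if "f \<in> hom (AEC_cat voc diagrams) M N" for f M N
      using that amap_colim_functor(1) by (auto simp: hom_AEC_cat)
    show "amap colim_functor (idt (AEC_cat voc diagrams) M) = idt K (omap colim_functor M)"
      if "M \<in> Obj (AEC_cat voc diagrams)" for M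
    proof -
      have M: "M \<in> diagrams" using that by simp
      show ?thesis unfolding AEC_cat_simps omap_colim_functor
        using idt_hom[OF leg(1)[OF M]] cmp_idt_left[OF leg(2)[OF M]]
        by (intro amap_colim_functor_eq[OF M]) simp_all
    qed
  next
    fix f M N g P
    assume f: "f \<in> hom (AEC_cat voc diagrams) M N" and g: "g \<in> hom (AEC_cat voc diagrams) N P"
    obtain h where h: "f = (M, h, N)" "M \<in> diagrams" "N \<in> diagrams" "embedding voc h M N"
      using f by (auto simp: hom_AEC_cat)
    obtain h' where h': "g = (N, h', P)" "P \<in> diagrams" "embedding voc h' N P"
      using g by (auto simp: hom_AEC_cat)
    note a = amap_colim_functor[OF h(2-4)] and a' = amap_colim_functor[OF h(3) h'(2,3)]
    have "amap colim_functor (M, compose (carrier M) h' h, P)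
        = cmp K (amap colim_functor g) (amap colim_functor f)"
    proof (rule amap_colim_functor_eq[OF h(2)])
      show "cmp K (amap colim_functor g) (amap colim_functor f) \<in> hom K (apex M) (apex P)"
        unfolding h(1) h'(1) using cmp_hom[OF a(1) a'(1)] .
      fix x assume x: "x \<in> carrier M"
      show "cmp K (cmp K (amap colim_functor g) (amap colim_functor f)) (leg M x)
          = leg P (compose (carrier M) h' h x)"
        unfolding h(1) h'(1) using cmp_assoc[OF leg(2)[OF h(2) x] a(1) a'(1)] a(2)[OF x]
          a'(2)[OF embedding_carrier[OF h(4) x]] x by (simp add: compose_eq)
    qed
    then show "amap colim_functor (cmp (AEC_cat voc diagrams) g f)
        = cmp K (amap colim_functor g) (amap colim_functor f)"
      by (simp add: h(1) h'(1))
  qed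
qed

text \<open>Over a common upper bound \<open>z\<close>, both legs factor through the monic
  \<open>leg M z\<close> by edges \<open>f\<close> and \<open>g\<close>. Equal legs and sorts force
  \<open>f = g\<close>, which the last diagram axiom forbids for distinct elements.\<close>

lemma leg_inj:
  assumes M: "M \<in> diagrams" and xy: "x \<in> carrier M" "y \<in> carrier M" "sort M x = sort M y"
    and eq: "leg M x = leg M y"
  shows "x = y"
proof -
  obtain z where z: "z \<in> carrier M" "(x, z) \<in> order M" "(y, z) \<in> order M"
    using directed_poset_bound2[OF \<nu> directed_order[OF M] xy(1,2)] by blast
  obtain f where f: "f \<in> arrs" "edge M f x z" "f \<in> hom K (sort M x) (sort M z)"
    using orderE[OF M z(2)] by metis
  obtain g where g: "g \<in> arrs" "edge M g y z" "g \<in> hom K (sort M y) (sort M z)"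
    using orderE[OF M z(3)] by metis
  have "f = g"
    using mono_cancel[OF all_mono leg(2)[OF M z(1)] f(3)] g(3) xy(3) eq
      leg(3)[OF M f(1,2)] leg(3)[OF M g(1,2)] by simp
  then show "x = y" using diagramsD(5)[OF M f(1,2)] g(2) by simp
qed

text \<open>The image arrow determines the leg of \<open>N\<close> at each \<open>h x\<close>, the
  sort of \<open>h x\<close> is that of \<open>x\<close>, and by \<open>leg_inj\<close> leg and sort
  determine the element.\<close>

lemma faithful_colim_functor: "faithful (AEC_cat voc diagrams) colim_functor"
  unfolding faithful_def
proof (intro ballI inj_onI)
  fix M N f g
  assume f: "f \<in> hom (AEC_cat voc diagrams) M N" and g: "g \<in> hom (AEC_cat voc diagrams) M N"
    and eq: "amap colim_functor f = amap colim_functor g"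
  obtain h where h: "f = (M, h, N)" "M \<in> diagrams" "N \<in> diagrams" "embedding voc h M N"
    using f by (auto simp: hom_AEC_cat)
  obtain h' where h': "g = (M, h', N)" "embedding voc h' M N"
    using g by (auto simp: hom_AEC_cat)
  have "h x = h' x" if x: "x \<in> carrier M" for x
  proof (rule leg_inj[OF h(3)])
    show "h x \<in> carrier N" "h' x \<in> carrier N" using embedding_carrier[OF h(4) x] embedding_carrier[OF h'(2) x] .
    show "sort N (h x) = sort N (h' x)"
      using sort_embedding[OF h(2-4) x] sort_embedding[OF h(2,3) h'(2) x] by simp
    show "leg N (h x) = leg N (h' x)"
      using amap_colim_functor(2)[OF h(2-4) x] amap_colim_functor(2)[OF h(2,3) h'(2) x] eq
      by (simp add: h(1) h'(1))
  qed
  then have "h = h'"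
    using extensionalityI[OF embedding_extensional[OF h(4)] embedding_extensional[OF h'(2)]] by blast
  then show "f = g" by (simp add: h(1) h'(1))
qed

end

section \<open>Directed colimits in a universal AEC\<close>

lemma universal_AECD:
  assumes "universal_AEC \<mu> \<tau> L"
  shows "is_vocabulary \<mu> \<tau>" "\<forall>M \<in> L. is_struct \<tau> M"
    "\<forall>M \<in> L. \<forall>N h. struct_iso \<tau> h M N \<longrightarrow> N \<in> L"
    "\<forall>N \<in> L. \<forall>M. substructure \<tau> M N \<longrightarrow> M \<in> L"
    "\<forall>I r M. directed_poset \<mu> I r \<longrightarrow> (\<forall>i \<in> I. M i \<in> L) \<longrightarrow>
      (\<forall>(i, j) \<in> r. substructure \<tau> (M i) (M j)) \<longrightarrow> struct_union \<tau> I M \<in> L"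
  using assms unfolding universal_AEC_def by - (elim conjE, assumption)+

text \<open>The union of the images of the legs is closed under functions, as arities are below
  \<mu>. It thus carries a substructure in \<open>L\<close>, and the colimit property gives an arrow
  from \<open>X\<close> into it that the inclusion turns into the identity. The maps
  \<open>e\<close> and \<open>g\<close> name the underlying functions of the legs and of the
  transition arrows.\<close>

lemma AEC_colimit_jointly_surjective:
  assumes L: "universal_AEC \<mu> \<tau> L" and \<mu>: "regular_cardinal \<mu>" and dir: "directed_poset \<mu> I r"
    and G: "is_functor (poset_cat I r) (AEC_cat \<tau> L) G"
    and colim: "is_colimit (poset_cat I r) (AEC_cat \<tau> L) G X c"
    and e: "\<And>i. i \<in> I \<Longrightarrow> c i = (omap G i, e i, X) \<and> embedding \<tau> (e i) (omap G i) X"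
    and g: "\<And>i j. (i, j) \<in> r \<Longrightarrow> amap G (i, j) = (omap G i, g i j, omap G j)
      \<and> embedding \<tau> (g i j) (omap G i) (omap G j)"
    and eg: "\<And>i j y. (i, j) \<in> r \<Longrightarrow> y \<in> carrier (omap G i) \<Longrightarrow> e j (g i j y) = e i y"
  shows "carrier X = (\<Union>i\<in>I. e i ` carrier (omap G i))"
proof -
  let ?D = "\<lambda>i. omap G i" and ?A = "AEC_cat \<tau> L"
  let ?V = "\<Union>i\<in>I. e i ` carrier (?D i)"
  have cocone: "is_cocone (poset_cat I r) ?A G X c" using colim by (simp add: is_colimit_def)
  then have X: "X \<in> L" by (simp add: is_cocone_poset_cat)
  have strX: "is_struct \<tau> X" using universal_AECD(2)[OF L] X by simp
  have GL: "?D i \<in> L" if "i \<in> I" for i using G that by (simp add: is_functor_poset_cat)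
  have VX: "?V \<subseteq> carrier X"
  proof (rule UN_least)
    fix i assume "i \<in> I"
    then show "e i ` carrier (?D i) \<subseteq> carrier X"
      using embedding_carrier[of \<tau> "e i" "?D i" X] e[of i] by (simp add: image_subset_iff)
  qed
  have mono: "e i ` carrier (?D i) \<subseteq> e j ` carrier (?D j)" if "(i, j) \<in> r" for i j
  proof
    fix x assume "x \<in> e i ` carrier (?D i)"
    then obtain y where y: "y \<in> carrier (?D i)" "x = e i y" by blast
    then have "x = e j (g i j y)" "g i j y \<in> carrier (?D j)"
      using eg[OF that y(1)] g[OF that] embedding_carrier[of \<tau> "g i j"] by auto
    then show "x \<in> e j ` carrier (?D j)" by blast
  qed
  have "fun_interp X f t \<in> ?V" if f: "f \<in> funs \<tau>" and t: "t \<in> fun_arity \<tau> f \<rightarrow>\<^sub>E ?V" for f t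
  proof -
    have "|fun_arity \<tau> f| <o \<mu>" using universal_AECD(1)[OF L] f by (simp add: is_vocabulary_def)
    then obtain i where i: "i \<in> I" and ti: "t \<in> fun_arity \<tau> f \<rightarrow>\<^sub>E e i ` carrier (?D i)"
      using directed_tuple_member[where A = "\<lambda>i. e i ` carrier (?D i)", OF dir _ mono t] by blast
    note ei = conjunct2[OF e[OF i]]
    obtain s where s: "s \<in> fun_arity \<tau> f \<rightarrow>\<^sub>E carrier (?D i)" "compose (fun_arity \<tau> f) (e i) s = t"
      using PiE_image_lift[OF ti] by blast
    have "fun_interp X f t = e i (fun_interp (?D i) f s)"
      using ei f s by (simp add: embedding_iff)
    moreover have "fun_interp (?D i) f s \<in> carrier (?D i)"
      using ei is_structD(2)[OF _ f s(1)] by (simp add: embedding_iff)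
    ultimately show ?thesis using i by blast
  qed
  then have sub: "substructure \<tau> (restrict_struct \<tau> X ?V) X" (is "substructure _ ?U _")
    using substructure_restrict_struct[OF strX VX] by blast
  have U: "?U \<in> L" using universal_AECD(4)[OF L] X sub by blast
  have eU: "embedding \<tau> (e i) (?D i) ?U" if "i \<in> I" for i
    using embedding_corestrict[OF conjunct2[OF e[OF that]] sub] UN_upper[OF that, of "\<lambda>i. e i ` carrier (?D i)"] by simp
  have cU: "is_cocone (poset_cat I r) ?A G ?U (\<lambda>i. (?D i, e i, ?U))"
    unfolding is_cocone_poset_cat
  proof (intro conjI ballI)
    show "?U \<in> Obj ?A" using U by simp
    show "(?D i, e i, ?U) \<in> hom ?A (?D i) ?U" if "i \<in> I" for i
      using that eU GL U by (simp add: hom_AEC_cat)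
    fix p assume p: "p \<in> r"
    obtain i j where ij: "p = (i, j)" by (cases p)
    have I: "i \<in> I" "j \<in> I" using directed_posetD(3)[OF dir] p ij by auto
    have "cmp ?A (c j) (amap G (i, j)) = c i"
      using cocone p ij by (auto simp: is_cocone_poset_cat)
    then show "case p of (i, j) \<Rightarrow> cmp ?A (?D j, e j, ?U) (amap G (i, j)) = (?D i, e i, ?U)"
      using e[OF I(1)] e[OF I(2)] g[of i j] p by (simp add: ij)
  qed
  obtain h where h: "h \<in> hom ?A X ?U" "\<And>i. i \<in> I \<Longrightarrow> cmp ?A h (c i) = (?D i, e i, ?U)"
    using colimit_desc[OF colim cU] unfolding poset_cat_simps(1) by blast
  obtain k where k: "h = (X, k, ?U)" "embedding \<tau> k X ?U" using h(1) by (auto simp: hom_AEC_cat)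
  interpret A: category ?A
    using category_AEC_cat[of L \<tau>] universal_AECD(2)[OF L] by simp
  have incl: "(?U, \<lambda>x\<in>?V. x, X) \<in> hom ?A ?U X"
    using embedding_inclusion[OF sub] U X by (simp add: hom_AEC_cat)
  \<comment> \<open>Both sides agree on all legs, so uniqueness of mediating arrows makes
    \<open>k\<close> a section of the inclusion. Thus \<open>k x = x\<close>, and every element of
    \<open>X\<close> lies in the union.\<close>
  have "cmp ?A (?U, \<lambda>x\<in>?V. x, X) h = idt ?A X"
  proof (rule colimit_eq[OF colim cocone])
    show "cmp ?A (?U, \<lambda>x\<in>?V. x, X) h \<in> hom ?A X X" using A.cmp_hom[OF h(1) incl] .
    show "idt ?A X \<in> hom ?A X X" using A.idt_hom X by simp
    fix i assume "i \<in> Obj (poset_cat I r)"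
    then have i: "i \<in> I" by simp
    then have ci: "c i \<in> hom ?A (?D i) X" using cocone by (simp add: is_cocone_poset_cat)
    have "e i \<in> carrier (?D i) \<rightarrow>\<^sub>E ?V" using eU[OF i] by (simp add: embedding_iff)
    then have "compose (carrier (?D i)) (\<lambda>x\<in>?V. x) (e i) = e i" by (rule compose_restrict_id)
    then show "cmp ?A (cmp ?A (?U, \<lambda>x\<in>?V. x, X) h) (c i) = c i"
      using A.cmp_assoc[OF ci h(1) incl] h(2)[OF i] e[OF i] by simp
    show "cmp ?A (idt ?A X) (c i) = c i" using A.cmp_idt_left[OF ci] .
  qed
  then have id: "compose (carrier X) (\<lambda>x\<in>?V. x) k = (\<lambda>x\<in>carrier X. x)"
    by (simp add: k(1))
  have "x \<in> ?V" if x: "x \<in> carrier X" for x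
  proof -
    have kx: "k x \<in> ?V" using embedding_carrier[OF k(2) x] by simp
    have "compose (carrier X) (\<lambda>x\<in>?V. x) k x = x" using id x by simp
    then have "k x = x" using x kx by (simp add: compose_eq)
    then show ?thesis using kx by simp
  qed
  then have "carrier X \<subseteq> ?V" by (rule subsetI)
  with VX show ?thesis by (rule equalityI[rotated])
qed

section \<open>Preservation of directed colimits\<close>

context generated_category
begin

text \<open>Every element of \<open>X\<close> comes from some stage of the diagram, and so does
  every edge. A cocone under the image diagram therefore assembles to a cocone over the diagram of
  \<open>X\<close>, and the arrow it induces out of \<open>apex X\<close> is the mediating
  one.\<close>

lemma preserves_colim_functor:
  "preserves_directed_colimits \<nu> (AEC_cat voc diagrams) K colim_functor"
  unfolding preserves_directed_colimits_def
proof (intro allI impI)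
  fix I :: "'u set" and r and G :: "('u, 'u \<times> 'u, 'u struct, 'u struct \<times> ('u \<Rightarrow> 'u) \<times> 'u struct) fnctr"
    and X c
  let ?A = "AEC_cat voc diagrams" and ?D = "\<lambda>i. omap G i" and ?F = colim_functor
  let ?FG = "functor_comp ?F G"
  assume dir: "directed_poset \<nu> I r" and G: "is_functor (poset_cat I r) ?A G"
    and colim: "is_colimit (poset_cat I r) ?A G X c"
  have cocone: "is_cocone (poset_cat I r) ?A G X c" using colim by (simp add: is_colimit_def)
  have X: "X \<in> diagrams" using cocone by (simp add: is_cocone_poset_cat)
  have D: "?D i \<in> diagrams" if "i \<in> I" for i using G that by (simp add: is_functor_poset_cat)
  define e where "e i = fst (snd (c i))" for i
  define g where "g i j = fst (snd (amap G (i, j)))" for i j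
  have e: "c i = (?D i, e i, X) \<and> embedding voc (e i) (?D i) X" if "i \<in> I" for i
  proof -
    have "c i \<in> hom ?A (?D i) X" using cocone that by (simp add: is_cocone_poset_cat)
    then show ?thesis by (auto simp: hom_AEC_cat e_def)
  qed
  have I: "i \<in> I" "j \<in> I" if "(i, j) \<in> r" for i j using directed_posetD(3)[OF dir] that by auto
  have g: "amap G (i, j) = (?D i, g i j, ?D j) \<and> embedding voc (g i j) (?D i) (?D j)"
    if "(i, j) \<in> r" for i j
  proof -
    have "amap G (i, j) \<in> hom ?A (?D i) (?D j)" using G that by (auto simp: is_functor_poset_cat)
    then show ?thesis by (auto simp: hom_AEC_cat g_def)
  qed
  have eg: "e j (g i j y) = e i y" if ij: "(i, j) \<in> r" and y: "y \<in> carrier (?D i)" for i j y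
  proof -
    have "cmp ?A (c j) (amap G (i, j)) = c i" using cocone ij by (auto simp: is_cocone_poset_cat)
    then have "compose (carrier (?D i)) (e j) (g i j) = e i"
      using e[OF I(1)[OF ij]] e[OF I(2)[OF ij]] g[OF ij] by simp
    then show ?thesis using y by (metis compose_eq)
  qed
  have surj: "carrier X = (\<Union>i\<in>I. e i ` carrier (?D i))"
    by (rule AEC_colimit_jointly_surjective[where e = e and g = g,
          OF universal_AEC_diagrams \<nu> dir G colim]) (fact e g eg)+
  have pre: "\<exists>i\<in>I. \<exists>y\<in>carrier (?D i). x = e i y" if "x \<in> carrier X" for x
    using that unfolding surj by blast
  have eE: "embedding voc (e i) (?D i) X" if "i \<in> I" for i using e that by simp
  have Fc: "amap ?F (c i) \<in> hom K (apex (?D i)) (apex X)"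
      "y \<in> carrier (?D i) \<Longrightarrow> cmp K (amap ?F (c i)) (leg (?D i) y) = leg X (e i y)" if "i \<in> I" for i y
    using amap_colim_functor[OF D[OF that] X eE[OF that]] e[OF that] by simp_all
  show "is_colimit (poset_cat I r) K ?FG (omap ?F X) (\<lambda>i. amap ?F (c i))"
    unfolding is_colimit_def
  proof (intro conjI allI impI)
    show "is_cocone (poset_cat I r) K ?FG (omap ?F X) (\<lambda>i. amap ?F (c i))"
      using is_cocone_functor_comp[OF is_functor_colim_functor G cocone] .
    fix Y d
    assume "is_cocone (poset_cat I r) K ?FG Y d"
    then have Y: "Y \<in> Obj K" and d: "\<And>i. i \<in> I \<Longrightarrow> d i \<in> hom K (apex (?D i)) Y"
      and dG: "\<And>i j. (i, j) \<in> r \<Longrightarrow> cmp K (d j) (amap ?F (amap G (i, j))) = d i"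
      by (auto simp: is_cocone_poset_cat functor_comp_def)
    have push: "cmp K (d j) (leg (?D j) (g i j y)) = cmp K (d i) (leg (?D i) y)"
      if ij: "(i, j) \<in> r" and y: "y \<in> carrier (?D i)" for i j y
    proof -
      note Fg = amap_colim_functor[OF D[OF I(1)[OF ij]] D[OF I(2)[OF ij]] conjunct2[OF g[OF ij]]]
      show ?thesis
        using cmp_assoc[OF leg(2)[OF D[OF I(1)[OF ij]] y] Fg(1) d[OF I(2)[OF ij]]] Fg(2)[OF y]
          dG[OF ij] g[OF ij] by simp
    qed
    have gc: "g i j y \<in> carrier (?D j)" if "(i, j) \<in> r" "y \<in> carrier (?D i)" for i j y
      using embedding_carrier[OF conjunct2[OF g[OF that(1)]] that(2)] .
    \<comment> \<open>Both elements are moved to a stage \<open>k\<close> above \<open>i\<close> and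
      \<open>j\<close>, where injectivity of \<open>e k\<close> identifies them; by
      \<open>push\<close>, moving does not change the composite.\<close>
    have welldef: "cmp K (d i) (leg (?D i) y) = cmp K (d j) (leg (?D j) y')"
      if ij: "i \<in> I" "j \<in> I" and y: "y \<in> carrier (?D i)" "y' \<in> carrier (?D j)" and eq: "e i y = e j y'"
      for i j y y'
    proof -
      obtain k where k: "k \<in> I" "(i, k) \<in> r" "(j, k) \<in> r"
        using directed_poset_bound2[OF \<nu> dir ij] by blast
      have "e k (g i k y) = e k (g j k y')" using eg k y eq by simp
      moreover have "inj_on (e k) (carrier (?D k))" using eE[OF k(1)] by (simp add: embedding_iff)
      ultimately have "g i k y = g j k y'" using gc k y by (meson inj_onD)
      then show ?thesis using push[OF k(2) y(1)] push[OF k(3) y(2)] by simp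
    qed
    \<comment> \<open>The candidate leg at \<open>x\<close> is computed from any preimage of
      \<open>x\<close> at any stage; \<open>welldef\<close> makes the choice immaterial.\<close>
    define m where "m x = (SOME k. \<exists>i\<in>I. \<exists>y\<in>carrier (?D i). x = e i y \<and> k = cmp K (d i) (leg (?D i) y))"
      for x
    have m: "m (e i y) = cmp K (d i) (leg (?D i) y)" if "i \<in> I" "y \<in> carrier (?D i)" for i y
      unfolding m_def
    proof (rule some_equality)
      fix k assume "\<exists>j\<in>I. \<exists>y'\<in>carrier (?D j). e i y = e j y' \<and> k = cmp K (d j) (leg (?D j) y')"
      then obtain j y' where "j \<in> I" "y' \<in> carrier (?D j)" "e i y = e j y'"
          "k = cmp K (d j) (leg (?D j) y')"
        by blast
      then show "k = cmp K (d i) (leg (?D i) y)" using welldef[OF that(1) _ that(2)] by simp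
    qed (use that in blast)
    have cY: "is_cocone (shape X) K (diagram X) Y m"
      unfolding is_cocone_diagram_iff[OF X]
    proof (intro conjI ballI allI impI)
      show "Y \<in> Obj K" by (fact Y)
      show "m x \<in> hom K (sort X x) Y" if x: "x \<in> carrier X" for x
      proof -
        obtain i y where i: "i \<in> I" "y \<in> carrier (?D i)" "x = e i y" using pre[OF x] by blast
        then show ?thesis
          using m[OF i(1,2)] cmp_hom[OF leg(2)[OF D[OF i(1)] i(2)] d[OF i(1)]]
            sort_embedding[OF D[OF i(1)] X eE[OF i(1)] i(2)] by simp
      qed
      fix f x x' assume f: "f \<in> arrs" "edge X f x x'"
      note xx' = edge_carrier[OF diagrams_struct[OF X] f]
      obtain i y where i: "i \<in> I" "y \<in> carrier (?D i)" "x = e i y" using pre[OF xx'(1)] by blast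
      obtain j y' where j: "j \<in> I" "y' \<in> carrier (?D j)" "x' = e j y'" using pre[OF xx'(2)] by blast
      obtain k where k: "k \<in> I" "(i, k) \<in> r" "(j, k) \<in> r"
        using directed_poset_bound2[OF \<nu> dir i(1) j(1)] by blast
      define w where "w = g i k y"
      define w' where "w' = g j k y'"
      have w: "w \<in> carrier (?D k)" "w' \<in> carrier (?D k)" "e k w = x" "e k w' = x'"
        using gc[OF k(2) i(2)] gc[OF k(3) j(2)] eg[OF k(2) i(2)] eg[OF k(3) j(2)] i(3) j(3)
        by (simp_all add: w_def w'_def)
      \<comment> \<open>Since \<open>e k\<close> reflects edges, the edge from \<open>x\<close> to
        \<open>x'\<close> already exists at stage \<open>k\<close>, where the legs are compatible
        with it.\<close>
      have E: "edge (?D k) f w w'"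
        using edge_embedding[OF eE[OF k(1)] f(1) w(1,2)] f(2) w(3,4) by simp
      show "cmp K (m x') f = m x"
        using m[OF k(1) w(1)] m[OF k(1) w(2)] w(3,4) leg(3)[OF D[OF k(1)] f(1) E]
          cmp_assoc[OF edge_hom[OF D[OF k(1)] f(1) E] leg(2)[OF D[OF k(1)] w(2)] d[OF k(1)]]
        by simp
    qed
    obtain h where h: "h \<in> hom K (apex X) Y" "\<And>x. x \<in> carrier X \<Longrightarrow> cmp K h (leg X x) = m x"
      using colimit_desc[OF is_colimit_colim[OF X] cY] unfolding poset_cat_simps(1) by blast
    \<comment> \<open>Turns equations between arrows out of the colimits of the stages into
      equations indexed by elements, for both existence and uniqueness of the mediating
      arrow.\<close>
    have Fcl: "cmp K (cmp K h' (amap ?F (c i))) (leg (?D i) y) = cmp K h' (leg X (e i y))"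
      if "h' \<in> hom K (apex X) Y" "i \<in> I" "y \<in> carrier (?D i)" for h' i y
      using cmp_assoc[OF leg(2)[OF D[OF that(2)] that(3)] Fc(1)[OF that(2)] that(1)]
        Fc(2)[OF that(2,3)] by simp
    have ec: "e i y \<in> carrier X" if "i \<in> I" "y \<in> carrier (?D i)" for i y
      using embedding_carrier[OF eE[OF that(1)] that(2)] .
    show "\<exists>!h. h \<in> hom K (omap ?F X) Y \<and>
        (\<forall>i\<in>Obj (poset_cat I r). cmp K h (amap ?F (c i)) = d i)"
    proof (rule ex1I[of _ h])
      have "cmp K h (amap ?F (c i)) = d i" if i: "i \<in> I" for i
        using Fcl[OF h(1) i] h(2)[OF ec[OF i]] m[OF i]
        by (intro apex_hom_eq[OF D[OF i] cmp_hom[OF Fc(1)[OF i] h(1)] d[OF i]]) simp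
      then show "h \<in> hom K (omap ?F X) Y \<and>
          (\<forall>i\<in>Obj (poset_cat I r). cmp K h (amap ?F (c i)) = d i)"
        using h(1) by simp
      fix h' assume "h' \<in> hom K (omap ?F X) Y \<and>
          (\<forall>i\<in>Obj (poset_cat I r). cmp K h' (amap ?F (c i)) = d i)"
      then have h': "h' \<in> hom K (apex X) Y" "\<And>i. i \<in> I \<Longrightarrow> cmp K h' (amap ?F (c i)) = d i" by simp_all
      show "h' = h"
      proof (rule apex_hom_eq[OF X h'(1) h(1)])
        fix x assume x: "x \<in> carrier X"
        obtain i y where i: "i \<in> I" "y \<in> carrier (?D i)" "x = e i y" using pre[OF x] by blast
        show "cmp K h' (leg X x) = cmp K h (leg X x)"
          using Fcl[OF h'(1) i(1,2)] h'(2)[OF i(1)] m[OF i(1,2)] h(2)[OF x] i(3) by simp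
      qed
    qed
  qed
qed

text \<open>A given diagram in \<open>S\<close> with colimit \<open>X\<close> may repeat a leg,
  which the last diagram axiom excludes. Passing to one index per subobject removes repetitions, and
  \<open>c\<close> restricted to these indices remains a colimit because each leg and that of its
  representative factor through each other.\<close>

lemma essentially_surjective_colim_functor:
  "essentially_surjective (AEC_cat voc diagrams) K colim_functor"
  unfolding essentially_surjective_def
proof (intro ballI)
  fix X assume X: "X \<in> Obj K"
  obtain I r G c where dir: "directed_poset \<nu> I r" and G: "is_functor (poset_cat I r) K G"
    and GS: "\<forall>i\<in>I. omap G i \<in> S" and colim: "is_colimit (poset_cat I r) K G X c"
    using generated[OF X] unfolding directed_colimit_of_def by blast
  have cocone: "is_cocone (poset_cat I r) K G X c" using colim by (simp add: is_colimit_def)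
  have c: "c i \<in> hom K (omap G i) X" if "i \<in> I" for i
    using cocone that by (simp add: is_cocone_poset_cat)
  \<comment> \<open>Legs are monic, so the factorizing arrow is unique, and \<open>le\<close> below
    compares legs as subobjects of \<open>X\<close>.\<close>
  define fac where "fac i j f \<longleftrightarrow> f \<in> hom K (omap G i) (omap G j) \<and> cmp K (c j) f = c i" for i j f
  define le where "le i j \<longleftrightarrow> (\<exists>f. fac i j f)" for i j
  have fac_id: "fac i i (idt K (omap G i))" if "i \<in> I" for i
    using c[OF that] cmp_idt_right[OF c[OF that]] idt_hom homD unfolding fac_def by blast
  have fac_cmp: "fac i k (cmp K g f)" if f: "fac i j f" and g: "fac j k g" and k: "k \<in> I" for i j k f g
    using f g cmp_assoc[of f _ _ g _ "c k"] c[OF k] cmp_hom unfolding fac_def by metis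
  have fac_unique: "f = g" if "fac i j f" "fac i j g" "j \<in> I" for i j f g
    using that mono_cancel[OF all_mono c[OF that(3)], of f "omap G i" g] unfolding fac_def by simp
  have fac_arrs: "f \<in> arrs" if "fac i j f" "i \<in> I" "j \<in> I" for i j f
    using that GS hom_arrs unfolding fac_def by blast
  have le_refl: "le i i" if "i \<in> I" for i using fac_id[OF that] unfolding le_def by blast
  have le_trans: "le i k" if "le i j" "le j k" "k \<in> I" for i j k
    using that fac_cmp unfolding le_def by blast
  have fac_r: "fac i j (amap G (i, j))" if "(i, j) \<in> r" for i j
    using that cocone G unfolding fac_def is_cocone_poset_cat is_functor_poset_cat by auto
  \<comment> \<open>Indices comparable both ways give the same subobject of \<open>X\<close>. The
    choice depends only on this class, so \<open>le\<close> becomes antisymmetric on the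
    representatives.\<close>
  define rep where "rep i = (SOME j. j \<in> I \<and> le i j \<and> le j i)" for i
  have rep: "rep i \<in> I \<and> le i (rep i) \<and> le (rep i) i" if "i \<in> I" for i
    unfolding rep_def
    by (rule someI[where P = "\<lambda>j. j \<in> I \<and> le i j \<and> le j i" and x = i]) (use that le_refl in blast)
  have rep_cong: "rep i = rep j" if ij: "i \<in> I" "j \<in> I" "le i j" "le j i" for i j
  proof -
    have "(k \<in> I \<and> le i k \<and> le k i) = (k \<in> I \<and> le j k \<and> le k j)" for k
      using le_trans ij by blast
    then show ?thesis unfolding rep_def by simp
  qed
  define J where "J = rep ` I"
  have JI: "J \<subseteq> I" using rep unfolding J_def by blast
  have rep_J: "rep a = a" if a: "a \<in> J" for a
  proof -
    obtain i where i: "i \<in> I" "a = rep i" using a unfolding J_def by blast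
    then show ?thesis using rep_cong[of a i] rep[OF i(1)] by simp
  qed
  have le_antisym: "a = b" if "a \<in> J" "b \<in> J" "le a b" "le b a" for a b
    using rep_cong[of a b] rep_J that JI by (metis subsetD)
  have bound: "\<exists>b\<in>J. \<forall>x\<in>Y. le x b" if Y: "Y \<subseteq> J" "|Y| <o \<nu>" for Y
  proof -
    \<comment> \<open>Edges of the original diagram are factorizations, so a bound in
      \<open>I\<close> is also one for \<open>le\<close>; its representative is a bound in
      \<open>J\<close>.\<close>
    obtain k where k: "k \<in> I" "\<forall>x\<in>Y. (x, k) \<in> r"
      using directed_poset_bound[OF dir subset_trans[OF Y(1) JI] Y(2)] by blast
    have "le x (rep k)" if "x \<in> Y" for x
    proof -
      have "le x k" using fac_r k(2) that unfolding le_def by blast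
      then show ?thesis using le_trans[of x k "rep k"] rep[OF k(1)] by blast
    qed
    then show ?thesis using k(1) unfolding J_def by blast
  qed
  define ub where "ub \<alpha> t = (SOME b. b \<in> J \<and> (\<forall>z\<in>underS \<nu> \<alpha>. le (t z) b))" for \<alpha> t
  have ub: "ub \<alpha> t \<in> J \<and> (\<forall>z\<in>underS \<nu> \<alpha>. le (t z) (ub \<alpha> t))"
    if \<alpha>: "\<alpha> \<in> Field \<nu>" and t: "t \<in> underS \<nu> \<alpha> \<rightarrow>\<^sub>E J" for \<alpha> t
  proof -
    have tJ: "t ` underS \<nu> \<alpha> \<subseteq> J" using PiE_mem[OF t] by blast
    have "|t ` underS \<nu> \<alpha>| <o \<nu>"
      using regular_cardinal_underS[OF \<nu> \<alpha>] by (rule card_of_image_ordLess)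
    then obtain b where "b \<in> J \<and> (\<forall>z\<in>underS \<nu> \<alpha>. le (t z) b)" using bound[OF tJ] by auto
    then show ?thesis unfolding ub_def
      by (rule someI[where P = "\<lambda>b. b \<in> J \<and> (\<forall>z\<in>underS \<nu> \<alpha>. le (t z) b)"])
  qed
  \<comment> \<open>The symbols for upper bounds are interpreted by \<open>ub\<close>. Injectivity
    of \<open>code\<close> will recover the arrow \<open>f\<close> from its relation symbol in
    \<open>edge_iff\<close>.\<close>
  define M where "M = \<lparr>carrier = J,
    fun_interp = (\<lambda>\<alpha>\<in>Field \<nu>. \<lambda>t \<in> underS \<nu> \<alpha> \<rightarrow>\<^sub>E J. ub \<alpha> t),
    rel_interp = (\<lambda>R. {pair a b | a b f. a \<in> J \<and> b \<in> J \<and> f \<in> arrs \<and> R = code f \<and> fac a b f})\<rparr>"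
  have cM: "carrier M = J" by (simp add: M_def)
  have edge_iff: "edge M f a b \<longleftrightarrow> a \<in> J \<and> b \<in> J \<and> fac a b f" if f: "f \<in> arrs" for f a b
  proof
    assume "edge M f a b"
    then obtain a' b' f' where p: "pair a b = pair a' b'" "a' \<in> J" "b' \<in> J" "f' \<in> arrs"
        "code f = code f'" "fac a' b' f'"
      unfolding edge_def M_def by auto
    then show "a \<in> J \<and> b \<in> J \<and> fac a b f"
      using inj_onD[OF inj_code p(5) f p(4)] by (simp add: pair_eq_iff)
  qed (use f in \<open>auto simp: edge_def M_def\<close>)
  have "is_struct voc M"
    unfolding is_struct_def
  proof (intro conjI ballI allI impI)
    show "small TYPE('u) (carrier M)"
      unfolding cM by (rule small_subset[OF directed_posetD(1)[OF dir] JI])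
    show "fun_interp M \<in> (\<Pi>\<^sub>E f\<in>funs voc. (fun_arity voc f \<rightarrow>\<^sub>E carrier M) \<rightarrow>\<^sub>E carrier M)"
      using ub by (simp add: M_def)
    show "rel_interp M R \<subseteq> rel_arity voc R \<rightarrow>\<^sub>E carrier M" for R
    proof
      fix t assume "t \<in> rel_interp M R"
      then obtain a b where "t = pair a b" "a \<in> J" "b \<in> J" unfolding M_def by auto
      then show "t \<in> rel_arity voc R \<rightarrow>\<^sub>E carrier M" by (simp add: cM pair_PiE)
    qed
    show "rel_interp M R = {}" if "R \<notin> rels voc" for R
      using that unfolding M_def by auto
  qed
  moreover have "diagram_axioms M x y z" if xyz: "x \<in> J" "y \<in> J" "z \<in> J" for x y z
    unfolding diagram_axioms_def
  proof (intro conjI ballI impI)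
    have "omap G x \<in> S" using GS JI xyz(1) by blast
    then show "\<exists>s\<in>S. edge M (idt K s) x x"
      using edge_iff[OF idt_arrs] fac_id JI xyz(1) by blast
  next
    fix f g assume fg: "f \<in> arrs" "g \<in> arrs" "edge M f x y" "edge M g y z"
    then have fac: "fac x y f" "fac y z g" using edge_iff by auto
    then show tr: "trg K f = src K g" by (auto simp: fac_def hom_def)
    show "edge M (cmp K g f) x z"
      using edge_iff[OF cmp_arrs[OF fg(1,2) tr]] fac_cmp[OF fac] xyz JI by blast
  next
    fix f g assume fg: "f \<in> arrs" "g \<in> arrs" "edge M f x y" "edge M g x y"
    then show "f = g" using edge_iff fac_unique JI xyz by blast
  next
    fix f g assume fg: "f \<in> arrs" "g \<in> arrs" "edge M f x y" "edge M g y x"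
    then show "x = y" using edge_iff le_antisym[OF xyz(1,2)] unfolding le_def by blast
  next
    fix f assume f: "f \<in> arrs" "edge M f x z" "edge M f y z"
    then have fac: "fac x z f" "fac y z f" using edge_iff by auto
    \<comment> \<open>Both legs equal \<open>c z\<close> after \<open>f\<close>, so the identity
      factors each through the other, and antisymmetry on representatives applies.\<close>
    then have eq: "c x = c y" "omap G x = omap G y" unfolding fac_def hom_def by auto
    have "fac x x (idt K (omap G x))" using fac_id JI xyz by blast
    then have "fac x y (idt K (omap G x))" "fac y x (idt K (omap G x))"
      using eq unfolding fac_def by simp_all
    then show "x = y" using le_antisym[OF xyz(1,2)] unfolding le_def by blast
  qed
  moreover have "bounds M \<alpha> t" if \<alpha>: "\<alpha> \<in> Field \<nu>" and t: "t \<in> underS \<nu> \<alpha> \<rightarrow>\<^sub>E J" for \<alpha> t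
    unfolding bounds_def
  proof
    fix z assume z: "z \<in> underS \<nu> \<alpha>"
    have "fun_interp M \<alpha> t = ub \<alpha> t" using \<alpha> t by (simp add: M_def)
    moreover obtain f where f: "fac (t z) (ub \<alpha> t) f" using ub[OF \<alpha> t] z unfolding le_def by blast
    moreover have J: "t z \<in> J" "ub \<alpha> t \<in> J" using PiE_mem[OF t z] ub[OF \<alpha> t] by auto
    moreover have fa: "f \<in> arrs" using fac_arrs[OF f] J JI by blast
    ultimately show "\<exists>f\<in>arrs. edge M f (t z) (fun_interp M \<alpha> t)" using edge_iff[OF fa] by auto
  qed
  ultimately have M: "M \<in> diagrams" by (simp add: diagrams_def cM)
  have sort: "sort M a = omap G a" if a: "a \<in> J" for a
  proof (rule sort_eq[OF M])
    show s: "omap G a \<in> S" using GS JI a by blast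
    show "edge M (idt K (omap G a)) a a" using edge_iff[OF idt_arrs[OF s]] fac_id a JI by blast
  qed
  have "is_colimit (shape M) K (diagram M) X c"
    unfolding is_colimit_def
  proof (intro conjI allI impI)
    show "is_cocone (shape M) K (diagram M) X c"
      unfolding is_cocone_diagram_iff[OF M] unfolding cM
    proof (intro conjI ballI allI impI)
      show "c x \<in> hom K (sort M x) X" if x: "x \<in> J" for x using sort[OF x] c subsetD[OF JI x] by simp
      show "cmp K (c y) f = c x" if "f \<in> arrs" "edge M f x y" for f x y
        using edge_iff[OF that(1)] that(2) unfolding fac_def by simp
    qed (rule X)
    fix Y d assume "is_cocone (shape M) K (diagram M) Y d"
    then have Y: "Y \<in> Obj K" and d: "\<And>a. a \<in> J \<Longrightarrow> d a \<in> hom K (omap G a) Y"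
      and de: "\<And>f a b. f \<in> arrs \<Longrightarrow> edge M f a b \<Longrightarrow> cmp K (d b) f = d a"
      unfolding is_cocone_diagram_iff[OF M] unfolding cM by (simp_all add: sort)
    have df: "cmp K (d b) f = d a" if ab: "a \<in> J" "b \<in> J" "fac a b f" for a b f
    proof -
      have f: "f \<in> arrs" using fac_arrs[OF ab(3)] ab(1,2) JI by blast
      then show ?thesis using de[OF f] edge_iff[OF f] ab by simp
    qed
    define u where "u i = (SOME f. fac i (rep i) f)" for i
    have u: "fac i (rep i) (u i)" if i: "i \<in> I" for i
    proof -
      obtain f where "fac i (rep i) f" using rep[OF i] unfolding le_def by blast
      then show ?thesis unfolding u_def by (rule someI[where P = "\<lambda>f. fac i (rep i) f"])
    qed
    have uh: "u i \<in> hom K (omap G i) (omap G (rep i))" "cmp K (c (rep i)) (u i) = c i" if "i \<in> I" for i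
      using u[OF that] unfolding fac_def by auto
    have rJ: "rep i \<in> J" if "i \<in> I" for i using that unfolding J_def by blast
    \<comment> \<open>A cocone given on \<open>J\<close> is extended to \<open>I\<close> by
      precomposing with the factorization \<open>u i\<close> of the leg at \<open>i\<close> through
      that of its representative.\<close>
    have cY: "is_cocone (poset_cat I r) K G Y (\<lambda>i. cmp K (d (rep i)) (u i))"
      unfolding is_cocone_poset_cat
    proof (intro conjI ballI)
      show "cmp K (d (rep i)) (u i) \<in> hom K (omap G i) Y" if "i \<in> I" for i
        using cmp_hom[OF uh(1)[OF that] d[OF rJ[OF that]]] .
      fix p assume p: "p \<in> r"
      obtain i j where ij: "p = (i, j)" by (cases p)
      have I: "i \<in> I" "j \<in> I" using directed_posetD(3)[OF dir] p ij by auto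
      have J: "rep i \<in> J" "rep j \<in> J" "rep i \<in> I" "rep j \<in> I" using rJ rep I by auto
      have Gij: "fac i j (amap G (i, j))" using fac_r p ij by simp
      obtain v where v: "fac (rep i) i v" using rep[OF I(1)] unfolding le_def by blast
      \<comment> \<open>An arrow between representatives: back from \<open>rep i\<close> to
        \<open>i\<close>, along the diagram edge, and on to \<open>rep j\<close>. Uniqueness of
        factorizations makes the resulting square commute.\<close>
      define w where "w = cmp K (u j) (cmp K (amap G (i, j)) v)"
      have w: "fac (rep i) (rep j) w"
        unfolding w_def using fac_cmp[OF fac_cmp[OF v Gij I(2)] u[OF I(2)] J(4)] .
      have wh: "w \<in> hom K (omap G (rep i)) (omap G (rep j))"
          and Gh: "amap G (i, j) \<in> hom K (omap G i) (omap G j)"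
        using w Gij unfolding fac_def by auto
      have "cmp K w (u i) = cmp K (u j) (amap G (i, j))"
        using fac_unique[OF fac_cmp[OF u[OF I(1)] w J(4)] fac_cmp[OF Gij u[OF I(2)] J(4)] J(4)] .
      moreover have "cmp K (d (rep j)) w = d (rep i)" using df[OF J(1,2) w] .
      ultimately have "cmp K (cmp K (d (rep j)) (u j)) (amap G (i, j)) = cmp K (d (rep i)) (u i)"
        using cmp_assoc[OF uh(1)[OF I(1)] wh d[OF J(2)]] cmp_assoc[OF Gh uh(1)[OF I(2)] d[OF J(2)]]
        by simp
      then show "case p of (i, j) \<Rightarrow>
          cmp K (cmp K (d (rep j)) (u j)) (amap G (i, j)) = cmp K (d (rep i)) (u i)"
        by (simp add: ij)
    qed (rule Y)
    have uJ: "cmp K (d (rep a)) (u a) = d a" if a: "a \<in> J" for a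
      using df[OF a _ u] rJ JI a by blast
    obtain h where h: "h \<in> hom K X Y" "\<And>i. i \<in> I \<Longrightarrow> cmp K h (c i) = cmp K (d (rep i)) (u i)"
      using colimit_desc[OF colim cY] unfolding poset_cat_simps(1) by blast
    show "\<exists>!h. h \<in> hom K X Y \<and> (\<forall>a\<in>Obj (shape M). cmp K h (c a) = d a)"
      unfolding poset_cat_simps(1) cM
    proof (rule ex1I[of _ h])
      show "h \<in> hom K X Y \<and> (\<forall>a\<in>J. cmp K h (c a) = d a)" using h uJ JI by auto
      fix h' assume h': "h' \<in> hom K X Y \<and> (\<forall>a\<in>J. cmp K h' (c a) = d a)"
      show "h' = h"
      \<comment> \<open>The values of \<open>h'\<close> are given only on legs from
        \<open>J\<close>; each \<open>c i\<close> is \<open>c (rep i)\<close> after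
        \<open>u i\<close>, so they determine \<open>h'\<close> on all of \<open>I\<close>.\<close>
      proof (rule colimit_eq[OF colim cY])
        show "h' \<in> hom K X Y" "h \<in> hom K X Y" using h' h(1) by auto
        fix i assume "i \<in> Obj (poset_cat I r)"
        then have i: "i \<in> I" by simp
        show "cmp K h (c i) = cmp K (d (rep i)) (u i)" using h(2)[OF i] .
        have "rep i \<in> I" using rep[OF i] by simp
        then show "cmp K h' (c i) = cmp K (d (rep i)) (u i)"
          using cmp_assoc[OF uh(1)[OF i] c conjunct1[OF h']] uh(2)[OF i] h' rJ[OF i] by simp
      qed
    qed
  qed
  then have "isomorphic K (apex M) X" using colimit_isomorphic[OF is_colimit_colim[OF M]] by blast
  then show "\<exists>M\<in>Obj (AEC_cat voc diagrams). isomorphic K (omap colim_functor M) X"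
    using M by auto
qed

end

section \<open>Change of index\<close>

lemma universal_AEC_mono:
  assumes L: "universal_AEC \<nu> \<tau> L" and le: "\<nu> \<le>o \<mu>"
  shows "universal_AEC \<mu> \<tau> L"
proof -
  have "is_vocabulary \<mu> \<tau>"
    using universal_AECD(1)[OF L] by (auto simp: is_vocabulary_def intro: ordLess_ordLeq_trans[OF _ le])
  moreover have "\<forall>I r M. directed_poset \<mu> I r \<longrightarrow> (\<forall>i \<in> I. M i \<in> L) \<longrightarrow>
      (\<forall>(i, j) \<in> r. substructure \<tau> (M i) (M j)) \<longrightarrow> struct_union \<tau> I M \<in> L"
  proof (intro allI impI)
    fix I r M
    assume "directed_poset \<mu> I r" "\<forall>i \<in> I. M i \<in> L" "\<forall>(i, j) \<in> r. substructure \<tau> (M i) (M j)"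
    then show "struct_union \<tau> I M \<in> L"
      using universal_AECD(5)[OF L, rule_format, OF directed_poset_mono[OF _ le], of I r M] by auto
  qed
  ultimately show ?thesis
    unfolding universal_AEC_def using universal_AECD(2-4)[OF L] by (intro conjI)
qed

lemma preserves_directed_colimits_mono:
  fixes \<mu> \<nu> :: "'u rel"
  assumes "preserves_directed_colimits \<nu> C D F" "\<nu> \<le>o \<mu>"
  shows "preserves_directed_colimits \<mu> C D F"
  using assms(1) directed_poset_mono[OF _ assms(2)]
  unfolding preserves_directed_colimits_def by blast

text \<open>The direction is opposite to that of the two preceding lemmas: exhibiting a directed
  diagram passes to a smaller index, while conditions on all directed diagrams pass to a larger
  one.\<close>

lemma directed_colimit_of_mono:
  fixes \<mu> \<nu> :: "'u rel"
  assumes "directed_colimit_of \<mu> C S X" "\<nu> \<le>o \<mu>"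
  shows "directed_colimit_of \<nu> C S X"
  using assms(1) directed_poset_mono[OF _ assms(2)]
  unfolding directed_colimit_of_def by blast

theorem theorem6p3:
  fixes \<mu> :: "'u rel" and K :: "('o, 'm) cat"
  assumes "regular_universe TYPE('u)"
    and "regular_cardinal \<mu>"
    and "accessible TYPE('u) K"
    and "has_directed_colimits \<mu> K"
    and "\<forall>f \<in> Arr K. monomorphism K f"
  shows "\<exists>(\<tau> :: 'u vocabulary) (L :: 'u struct set)
      (F :: ('u struct, 'u struct \<times> ('u \<Rightarrow> 'u) \<times> 'u struct, 'o, 'm) fnctr).
    universal_AEC \<mu> \<tau> L \<and>
    is_functor (AEC_cat \<tau> L) K F \<and>
    essentially_surjective (AEC_cat \<tau> L) K F \<and>
    faithful (AEC_cat \<tau> L) F \<and>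
    preserves_directed_colimits \<mu> (AEC_cat \<tau> L) K F"
proof -
  obtain \<kappa> :: "'u rel" where \<kappa>: "regular_cardinal \<kappa>" "accessible_at \<kappa> K"
    using assms(3) unfolding accessible_def by blast
  obtain S where S: "small TYPE('u) S" "\<forall>X\<in>S. presentable \<kappa> K X"
      "\<forall>X\<in>Obj K. directed_colimit_of \<kappa> K S X"
    using \<kappa>(2) unfolding accessible_at_def by blast
  have K: "category K" "locally_small TYPE('u) K" "has_directed_colimits \<kappa> K"
    using \<kappa>(2) unfolding accessible_at_def by blast+
  have wo: "Well_order \<kappa>" "Well_order \<mu>"
    using \<kappa>(1) assms(2) regular_cardinal_Well_order by auto
  have "\<exists>\<nu>. \<nu> \<le>o \<mu> \<and> \<nu> \<le>o \<kappa> \<and> (\<nu> = \<kappa> \<or> \<nu> = \<mu>)"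
  proof (cases "\<kappa> \<le>o \<mu>")
    case True
    then show ?thesis using ordLeq_reflexive[OF wo(1)] by (intro exI[of _ \<kappa>]) simp
  next
    case False
    then have "\<mu> \<le>o \<kappa>" using ordLeq_total[OF wo] by simp
    then show ?thesis using ordLeq_reflexive[OF wo(2)] by (intro exI[of _ \<mu>]) simp
  qed
  then obtain \<nu> :: "'u rel" where \<nu>: "\<nu> \<le>o \<mu>" "\<nu> \<le>o \<kappa>" "\<nu> = \<kappa> \<or> \<nu> = \<mu>"
    by (elim exE conjE)
  have S_Obj: "S \<subseteq> Obj K" using S(2) unfolding presentable_def by blast
  have gen: "directed_colimit_of \<nu> K S X" if "X \<in> Obj K" for X
    using S(3) that by (intro directed_colimit_of_mono[OF _ \<nu>(2)]) simp
  \<comment> \<open>In either case \<nu> is an index for which \<open>K\<close> has directed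
    colimits: \<kappa> by accessibility, \<mu> by hypothesis.\<close>
  have "regular_cardinal \<nu>" "has_directed_colimits \<nu> K"
    using \<nu>(3) \<kappa>(1) assms(2,4) K(3) by auto
  then interpret P: generated_category K \<nu> S
    using assms(1,5) K(1,2) S(1) S_Obj gen
    by (intro generated_category.intro generated_category_axioms.intro)
  show ?thesis
    by (intro exI conjI, rule universal_AEC_mono[OF P.universal_AEC_diagrams \<nu>(1)],
        rule P.is_functor_colim_functor, rule P.essentially_surjective_colim_functor,
        rule P.faithful_colim_functor,
        rule preserves_directed_colimits_mono[OF P.preserves_colim_functor \<nu>(1)])
qed

end
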